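(* Let $\mathcal G(N,d)$ denote the collection of all chordal graphs on $N$ vertices with maximum degree at most $d$. There is an absolute constant $C$ such that for all integers $N\ge1$, $d\ge 1$ and all $0<p<1/2$, $$\inf_{\widehat{\mathsf{cc}}}\ \sup_{G\in\mathcal G(N,d)}\mathbb E_G|\widehat{\mathsf{cc}}-\mathsf{cc}(G)|^2\le C\,N^2\left(N/d^2\right)^{-\frac{p}{2-3p}}.$$
   Context: Graphs are finite, simple and undirected; $\mathsf{cc}(G)$ is the number of connected components of $G$. A graph is chordal if it has no induced cycle of length four or more. Bernoulli sampling model: given a (deterministic, unknown) graph $G=(V,E)$, each vertex is included in a random set $S\subset V$ independently with probability $p$, and one observes the induced subgraph $\widetilde G=G[S]$ (up to isomorphism). An estimator $\widehat{\mathsf{cc}}$ is any real-valued function of $\widetilde G$ (it may depend on the known parameters $N,d,p$); $\mathbb E_G$ is the expectation when the parent graph is $G$. *)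

theory Defs
  imports "HOL-Probability.Probability" "Graph_Theory.Graph_Theory"
begin

text \<open>
  A finite simple undirected graph is a \<^locale>\<open>pair_graph\<close>: a finite, loop-free and symmetric
  digraph whose arcs are ordered pairs, so that each edge is represented by its two orientations.
  Degrees are therefore out-degrees, and connected components are strongly connected components.
  Vertices are natural numbers, which covers all finite graphs up to isomorphism.
\<close>

definition cycle_graph :: "nat \<Rightarrow> nat pair_pre_digraph" where
  "cycle_graph k =
     \<lparr> pverts = {..<k},
       parcs = {(i, j). i < k \<and> j < k \<and> (j = Suc i mod k \<or> i = Suc j mod k)} \<rparr>"

definition chordal :: "nat pair_pre_digraph \<Rightarrow> bool" where
  "chordal G \<longleftrightarrow>
     \<not> (\<exists>U k. U \<subseteq> pverts G \<and> 4 \<le> k \<and>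
          digraph_iso (with_proj G \<restriction> U) (with_proj (cycle_graph k)))"

definition chordal_graphs :: "nat \<Rightarrow> nat \<Rightarrow> nat pair_pre_digraph set" where
  "chordal_graphs N d =
     {G. pair_graph G \<and> chordal G \<and> card (pverts G) = N \<and>
         (\<forall>v \<in> pverts G. out_degree (with_proj G) v \<le> d)}"

definition cc :: "nat pair_pre_digraph \<Rightarrow> nat" where
  "cc G = card (pre_digraph.sccs (with_proj G))"

definition bernoulli_subset :: "'a set \<Rightarrow> real \<Rightarrow> 'a set pmf" where
  "bernoulli_subset V p =
     map_pmf (\<lambda>b. {v \<in> V. b v}) (Pi_pmf V False (\<lambda>_. bernoulli_pmf p))"

text \<open>
  The observed graph is known only up to isomorphism, so an estimator is an
  isomorphism-invariant real function of it.
\<close>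

definition estimators :: "((nat, nat \<times> nat) pre_digraph \<Rightarrow> real) set" where
  "estimators = {est. \<forall>G H. digraph_iso G H \<longrightarrow> est G = est H}"

definition mean_squared_error ::
  "((nat, nat \<times> nat) pre_digraph \<Rightarrow> real) \<Rightarrow> real \<Rightarrow> nat pair_pre_digraph \<Rightarrow> real" where
  "mean_squared_error est p G =
     measure_pmf.expectation (bernoulli_subset (pverts G) p)
       (\<lambda>S. \<bar>est (with_proj G \<restriction> S) - real (cc G)\<bar>\<^sup>2)"

text \<open>
  The infimum and supremum are taken in the complete lattice \<^typ>\<open>ennreal\<close>, where both are total.
\<close>

definition minimax_risk :: "nat \<Rightarrow> nat \<Rightarrow> real \<Rightarrow> ennreal" where
  "minimax_risk N d p =
     (INF est \<in> estimators. SUP G \<in> chordal_graphs N d. ennreal (mean_squared_error est p G))"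

end

theory Submission
  imports Defs
begin

text \<open>
  A chordal graph has a perfect elimination ordering. If \<open>P v\<close> is the set of neighbours of \<open>v\<close> that are
  eliminated after \<open>v\<close>, then \<open>cc(G)\<close> is the number of \<open>v\<close> with \<open>P v\<close> empty, and, by binomial inversion,
  every sum \<open>\<Sum>v\<in>S. g |P v \<inter> S|\<close> is a linear combination of clique counts of the observed graph, so it
  is an estimator. The choice \<open>g k = (-q/p)^k P(L \<ge> k) / p\<close> with \<open>q = 1 - p\<close> and \<open>L\<close> Poisson of mean \<open>a\<close> has
  bias \<open>q^c e\<^sup>-\<^sup>a L\<^bsub>c-1\<^esub>(a)\<close> at a vertex with \<open>c = |P v| > 0\<close>, where \<open>|L\<^sub>n(a)| \<le> exp (a/2)\<close> for the Laguerre
  polynomials, while \<open>|g| \<le> exp (a (1-2p)/p) / p\<close>. Contributions of vertices at distance more than two are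
  independent, so the mean squared error is at most
  \<open>N\<^sup>2 e\<^sup>-\<^sup>a + 16 N d\<^sup>2 exp (2a (1-2p)/p) / p\<^sup>2\<close>. The two terms balance at \<open>a = p/(2-3p) ln (N/d\<^sup>2)\<close>; decreasing
  this \<open>a\<close> by one gains a factor \<open>exp (-2/p)\<close> in the second term, which absorbs \<open>1/p\<^sup>2\<close>.
\<close>

section \<open>Charlier and Laguerre polynomials\<close>

text \<open>With the usual normalisation, this is \<open>a\<^sup>n C\<^sub>n(x; a)\<close>; the falling factorial of \<open>x\<close> is written
  \<open>fact k * (x choose k)\<close>.\<close>

definition charlier :: "real \<Rightarrow> nat \<Rightarrow> nat \<Rightarrow> real" where
  "charlier a n x =
     (\<Sum>k\<le>n. (-1)^k * a^(n-k) * real (n choose k) * fact k * real (x choose k))"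

lemma charlier_0 [simp]: "charlier a 0 x = 1"
  by (simp add: charlier_def)

lemma charlier_at_0: "charlier a n 0 = a ^ n"
  unfolding charlier_def by (subst sum.remove [of _ 0]) (auto intro!: sum.neutral)

lemma charlier_Suc_expand:
  "charlier a (Suc n) x = a ^ Suc n +
     (\<Sum>k\<le>n. (-1)^Suc k * a^(n-k) * (real (Suc n choose Suc k) * fact (Suc k)) * real (x choose Suc k))"
  unfolding charlier_def sum.atMost_Suc_shift
  by (simp only: diff_Suc_Suc mult.assoc) simp

text \<open>In falling factorials, \<open>(n+1)_(k+1) = (n+1) (n)_k\<close>. Both recursions below
  use it, once in the degree and once in the argument.\<close>

lemma Suc_choose_Suc_times_fact:
  "real (Suc n choose Suc k) * fact (Suc k) = real (Suc n) * (real (n choose k) * fact k)"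
proof -
  have "real ((Suc n choose Suc k) * Suc k) = real (Suc n * (n choose k))"
    by (simp only: Suc_times_binomial_eq)
  then show ?thesis unfolding fact_Suc of_nat_mult by (metis (no_types) mult.assoc)
qed

text \<open>The forward difference in \<open>x\<close> lowers the degree: Pascal's rule turns
  \<open>x choose Suc k\<close> into \<open>x choose k\<close>, and absorption extracts the factor
  \<open>Suc n\<close>.\<close>

lemma charlier_Suc_right:
  "charlier a (Suc n) (Suc x) = charlier a (Suc n) x - real (Suc n) * charlier a n x"
proof -
  have "charlier a (Suc n) (Suc x) - charlier a (Suc n) x =
      (\<Sum>k\<le>n. (-1)^Suc k * a^(n-k) * (real (Suc n choose Suc k) * fact (Suc k)) * real (x choose k))"
    unfolding charlier_Suc_expand add_diff_add sum_subtractf [symmetric] right_diff_distrib [symmetric]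
    by simp
  also have "\<dots> = - (real (Suc n) * charlier a n x)"
    unfolding Suc_choose_Suc_times_fact charlier_def sum_distrib_left sum_negf [symmetric]
    by (intro sum.cong) simp_all
  finally show ?thesis by simp
qed

text \<open>Pascal's rule in the degree splits the sum: one half reassembles to
  \<open>a * charlier a n x\<close>, the other drops \<open>x\<close> by one through absorption. At
  \<open>x = 0\<close> the truncated \<open>x - 1\<close> is harmless, being multiplied by
  \<open>x\<close>.\<close>

lemma charlier_Suc_left:
  "charlier a (Suc n) x = a * charlier a n x - real x * charlier a n (x - 1)"
proof -
  have *: "real (x choose Suc k) * fact (Suc k) = real x * (real (x - 1 choose k) * fact k)" for k
    using Suc_choose_Suc_times_fact [of "x - 1" k] by (cases x) auto
  have "charlier a (Suc n) x = a ^ Suc n +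
     (\<Sum>k\<le>n. (-1)^Suc k * a^(n-k) * real (n choose Suc k) * fact (Suc k) * real (x choose Suc k)) +
     (\<Sum>k\<le>n. (-1)^Suc k * a^(n-k) * real (n choose k) * (real (x choose Suc k) * fact (Suc k)))"
    unfolding charlier_Suc_expand binomial_Suc_Suc of_nat_add add.assoc sum.distrib [symmetric]
    by (intro arg_cong [where f = "\<lambda>y. a ^ Suc n + y"] sum.cong refl)
       (simp only: distrib_left distrib_right mult_ac add.commute)
  also have "a ^ Suc n +
     (\<Sum>k\<le>n. (-1)^Suc k * a^(n-k) * real (n choose Suc k) * fact (Suc k) * real (x choose Suc k)) =
     (\<Sum>k\<le>Suc n. (-1)^k * a^(Suc n-k) * real (n choose k) * fact k * real (x choose k))"
    unfolding sum.atMost_Suc_shift by simp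
  also have "\<dots> = a * charlier a n x"
    unfolding charlier_def sum_distrib_left
    by (simp add: Suc_diff_le mult_ac)
  also have "(\<Sum>k\<le>n. (-1)^Suc k * a^(n-k) * real (n choose k) * (real (x choose Suc k) * fact (Suc k)))
     = - (real x * charlier a n (x - 1))"
    unfolding * charlier_def sum_distrib_left sum_negf [symmetric]
    by (intro sum.cong) simp_all
  finally show ?thesis by simp
qed

text \<open>A crude bound, exponential in \<open>x\<close>; it serves only to make a series with
  weights \<open>a ^ x / fact x\<close> converge.\<close>

lemma abs_charlier_le:
  assumes "0 \<le> a"
  shows "\<bar>charlier a n x\<bar> \<le> fact n * (1 + a) ^ n * 2 ^ x"
proof (induction x arbitrary: n)
  case 0
  have "a ^ n \<le> (1 + a) ^ n" by (rule power_mono) (use assms in auto)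
  also have "\<dots> \<le> fact n * (1 + a) ^ n"
    using mult_right_mono [OF fact_ge_1 [of n, where ?'a = real], of "(1+a)^n"] assms by simp
  finally show ?case using assms by (simp add: charlier_at_0)
next
  case (Suc x)
  show ?case
  proof (cases n)
    case 0
    then show ?thesis using one_le_power [of "2::real" "Suc x"] by simp
  next
    case n: (Suc m)
    have "\<bar>charlier a n (Suc x)\<bar> \<le> \<bar>charlier a n x\<bar> + real (Suc m) * \<bar>charlier a m x\<bar>"
      unfolding n charlier_Suc_right by (rule order_trans [OF abs_triangle_ineq4]) (simp add: abs_mult)
    also have "\<dots> \<le> fact n * (1 + a) ^ n * 2 ^ x + real (Suc m) * (fact m * (1 + a) ^ m * 2 ^ x)"
      by (intro add_mono mult_left_mono Suc.IH) auto
    also have "real (Suc m) * (fact m * (1 + a) ^ m * 2 ^ x) = fact n * (1 + a) ^ m * 2 ^ x"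
      by (simp add: n)
    also have "\<dots> \<le> fact n * (1 + a) ^ n * 2 ^ x"
      using power_increasing [of m n "1 + a"] assms n by (intro mult_right_mono mult_left_mono) auto
    finally show ?thesis by simp
  qed
qed

text \<open>The squared norm under unnormalised Poisson weights. Expanding one factor of the square
  by \<open>charlier_Suc_left\<close> gives two mixed sums; after shifting \<open>x\<close> in the
  second, \<open>charlier_Suc_right\<close> makes them cancel up to \<open>a * Suc n\<close> times
  the previous norm.\<close>

lemma charlier_norm:
  assumes "0 \<le> a"
  shows "(\<lambda>x. a ^ x / fact x * (charlier a n x)\<^sup>2) sums (exp a * a ^ n * fact n)"
proof (induction n)
  case 0
  show ?case using exp_converges [of a] by (simp add: divide_inverse mult.commute)
next
  case (Suc n)
  define s where "s = exp a * a ^ n * fact n"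
  define f where "f x = a ^ x / fact x * (charlier a n x)\<^sup>2" for x
  define u where "u x = a ^ x / fact x * (charlier a n x * charlier a (Suc n) x)" for x
  define v where "v x = u x - real (Suc n) * f x" for x
  define w where "w x = real x * (a ^ x / fact x) * (charlier a n (x - 1) * charlier a (Suc n) x)" for x
  define K where "K = fact n * (1 + a) ^ n * (fact (Suc n) * (1 + a) ^ Suc n)"
  \<comment> \<open>Each of the two factors in \<open>u\<close> grows at most like
    \<open>2 ^ x\<close>, hence the \<open>4\<close>. Only convergence is needed, since the value
    \<open>U\<close> cancels at the end.\<close>
  have "summable (\<lambda>x. K * ((4 * a) ^ x / fact x))"
    using exp_converges [of "4 * a"]
    by (intro summable_mult sums_summable [of _ "exp (4 * a)"]) (simp add: divide_inverse mult.commute)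
  then have "summable u"
  proof (rule summable_comparison_test' [where N = 0])
    fix x :: nat
    have "norm (u x) = a ^ x / fact x * (\<bar>charlier a n x\<bar> * \<bar>charlier a (Suc n) x\<bar>)"
      using assms by (simp add: u_def abs_mult)
    also have "\<dots> \<le> a ^ x / fact x * ((fact n * (1 + a) ^ n * 2 ^ x) * (fact (Suc n) * (1 + a) ^ Suc n * 2 ^ x))"
      by (intro mult_left_mono mult_mono abs_charlier_le) (use assms in auto)
    also have "\<dots> = K * ((4 * a) ^ x / fact x)"
      using power_mult_distrib [of "2::real" 2 x] by (simp add: K_def power_mult_distrib)
    finally show "norm (u x) \<le> K * ((4 * a) ^ x / fact x)" .
  qed
  then obtain U where U: "u sums U" by (auto simp: summable_def)
  have v: "v sums (U - real (Suc n) * s)"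
    unfolding v_def by (intro sums_diff U sums_mult) (use Suc in \<open>simp add: f_def s_def\<close>)
  have "w (Suc x) = a * v x" for x
    by (simp add: w_def v_def u_def f_def charlier_Suc_right field_simps power2_eq_square del: of_nat_Suc)
  then have "(\<lambda>x. w (Suc x)) sums (a * (U - real (Suc n) * s))"
    using sums_mult [OF v, of a] by simp
  \<comment> \<open>Since \<open>w 0 = 0\<close>, undoing the shift adds no term.\<close>
  then have "w sums (a * (U - real (Suc n) * s))"
    using sums_Suc_iff [of w "a * (U - real (Suc n) * s)"] by (simp add: w_def)
  then have "(\<lambda>x. a * u x - w x) sums (a * U - a * (U - real (Suc n) * s))"
    by (intro sums_diff sums_mult U)
  \<comment> \<open>The occurrence rewritten is one of the two factors of the square; the other
    stays intact.\<close>
  moreover have "a * u x - w x = a ^ x / fact x * (charlier a (Suc n) x)\<^sup>2" for x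
    unfolding u_def w_def power2_eq_square by (subst (3) charlier_Suc_left) (simp add: algebra_simps)
  ultimately show ?case by (simp add: s_def algebra_simps)
qed

text \<open>Reverse the summation by \<open>l = n - k\<close>; one binomial together with
  \<open>fact (n - l)\<close> collapses to \<open>fact n / fact l\<close>.\<close>

lemma charlier_diagonal:
  "charlier a n n = (-1)^n * fact n * (\<Sum>l\<le>n. real (n choose l) * (- a) ^ l / fact l)"
proof -
  have "charlier a n n =
      (\<Sum>l\<le>n. (-1)^(n-l) * a^l * real (n choose (n-l)) * fact (n-l) * real (n choose (n-l)))"
    unfolding charlier_def
    by (rule sum.reindex_bij_witness [of _ "\<lambda>l. n - l" "\<lambda>l. n - l"]) auto
  also have "\<dots> = (\<Sum>l\<le>n. (-1)^n * fact n * (real (n choose l) * (- a) ^ l / fact l))"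
  proof (intro sum.cong refl)
    fix l assume "l \<in> {..n}"
    then have l: "l \<le> n" by simp
    have b: "real (n choose l) * fact (n - l) = fact n / fact l"
      using binomial_fact_lemma [OF l] l by (simp add: binomial_fact)
    have sg: "(-1 :: real)^(n-l) = (-1)^n * (-1)^l"
      using l by (auto simp: minus_one_power_iff)
    have "(-1)^(n-l) * a^l * real (n choose (n-l)) * fact (n-l) * real (n choose (n-l)) =
       (-1)^(n-l) * a^l * (real (n choose l) * fact (n - l)) * real (n choose l)"
      using binomial_symmetric [OF l] by simp
    also have "\<dots> = (-1)^n * fact n * (real (n choose l) * (- a) ^ l / fact l)"
      unfolding b sg power_minus [of a l] by simp
    finally show "(-1)^(n-l) * a^l * real (n choose (n-l)) * fact (n-l) * real (n choose (n-l)) =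
       (-1)^n * fact n * (real (n choose l) * (- a) ^ l / fact l)" .
  qed
  finally show ?thesis by (simp add: sum_distrib_left)
qed

text \<open>The sum is the Laguerre polynomial \<open>L\<^sub>n(a)\<close>, a Charlier value on the diagonal; the bound keeps
  only the term \<open>x = n\<close> of the Poisson norm.\<close>

lemma abs_laguerre_le:
  fixes a :: real
  assumes "0 \<le> a"
  shows "\<bar>\<Sum>l\<le>n. real (n choose l) * (- a) ^ l / fact l\<bar> \<le> exp (a / 2)" (is "\<bar>?L\<bar> \<le> _")
proof (cases "a = 0")
  \<comment> \<open>The general case cancels a factor \<open>a ^ n\<close>, so \<open>a = 0\<close>
    is separate; only the term \<open>l = 0\<close> survives there.\<close>
  case True
  then show ?thesis by (cases n) (simp_all add: sum.atMost_Suc_shift)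
next
  case False
  with assms have a: "0 < a" by simp
  have "a ^ n / fact n * (charlier a n n)\<^sup>2 \<le> exp a * a ^ n * fact n"
    using sum_le_suminf [OF sums_summable [OF charlier_norm [OF assms, of n]], of "{n}"]
      sums_unique [OF charlier_norm [OF assms, of n]] assms by simp
  moreover have "(charlier a n n)\<^sup>2 = (fact n)\<^sup>2 * ?L\<^sup>2"
    by (simp add: charlier_diagonal power_mult_distrib flip: power_mult)
  ultimately have "?L\<^sup>2 * (a ^ n * fact n) \<le> exp a * (a ^ n * fact n)"
    by (simp add: power2_eq_square field_simps)
  then have "?L\<^sup>2 \<le> exp a" using a by simp
  also have "\<dots> = (exp (a / 2))\<^sup>2" by (simp add: power2_eq_square flip: exp_add)
  finally show ?thesis using abs_le_square_iff [of ?L "exp (a / 2)"] by simp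
qed

section \<open>Tails of the Poisson distribution\<close>

text \<open>This is \<open>P(L \<ge> k)\<close> for \<open>L\<close> Poisson of mean
  \<open>a\<close>, in a form whose successive differences are visibly the point masses.\<close>

definition poisson_tail :: "real \<Rightarrow> nat \<Rightarrow> real" where
  "poisson_tail a k = 1 - exp (- a) * (\<Sum>l<k. a ^ l / fact l)"

lemma poisson_tail_0 [simp]: "poisson_tail a 0 = 1"
  by (simp add: poisson_tail_def)

lemma poisson_tail_sums:
  "(\<lambda>l. exp (- a) * (a ^ (l + k) / fact (l + k))) sums poisson_tail a k"
proof -
  have "(\<lambda>l. exp (- a) * (a ^ l / fact l)) sums (exp (- a) * exp a)"
    using exp_converges [of a] by (intro sums_mult) (simp add: divide_inverse mult.commute)
  then have "(\<lambda>l. exp (- a) * (a ^ l / fact l)) sums 1" by (simp flip: exp_add)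
  from sums_split_initial_segment [OF this, of k] show ?thesis
    by (simp add: poisson_tail_def sum_distrib_left)
qed

lemma poisson_tail_nonneg: "0 \<le> a \<Longrightarrow> 0 \<le> poisson_tail a k"
  by (rule sums_le [OF _ sums_zero poisson_tail_sums]) auto

text \<open>Exponential tilting: on \<open>l \<ge> k\<close> one has
  \<open>r ^ k \<le> r ^ l\<close>, and the weights \<open>r ^ l\<close> turn mean \<open>a\<close>
  into mean \<open>r * a\<close> at the cost of the factor \<open>exp (a * (r - 1))\<close>. The
  tilted tail is at most 1.\<close>

lemma power_poisson_tail_le:
  assumes "0 \<le> a" "1 \<le> r"
  shows "r ^ k * poisson_tail a k \<le> exp (a * (r - 1))"
proof -
  have "(\<lambda>l. exp (- a) * ((r * a) ^ (l + k) / fact (l + k))) sums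
      (exp (r * a - a) * poisson_tail (r * a) k)"
    using sums_mult [OF poisson_tail_sums [of "r * a" k], of "exp (r * a - a)"]
    by (simp add: mult.assoc [symmetric] flip: exp_add)
  then have "r ^ k * poisson_tail a k \<le> exp (r * a - a) * poisson_tail (r * a) k"
  proof (rule sums_le [rotated, OF sums_mult [OF poisson_tail_sums]])
    fix l
    have "r ^ k \<le> r ^ (l + k)" using assms by (intro power_increasing) auto
    then have "r ^ k * (exp (- a) * (a ^ (l + k) / fact (l + k)))
        \<le> r ^ (l + k) * (exp (- a) * (a ^ (l + k) / fact (l + k)))"
      by (intro mult_right_mono) (use assms in auto)
    then show "r ^ k * (exp (- a) * (a ^ (l + k) / fact (l + k)))
        \<le> exp (- a) * ((r * a) ^ (l + k) / fact (l + k))"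
      by (simp add: power_mult_distrib mult_ac)
  qed
  also have "poisson_tail (r * a) k \<le> 1"
    using assms by (simp add: poisson_tail_def sum_nonneg)
  finally show ?thesis using assms by (simp add: algebra_simps)
qed

text \<open>Summation by parts: Pascal's rule moves the alternation onto
  \<open>P(L \<ge> k) - P(L \<ge> k + 1) = P(L = k)\<close>, which leaves a Laguerre
  polynomial.\<close>

lemma alternating_poisson_tail_sum:
  "(\<Sum>k\<le>Suc n. real (Suc n choose k) * (-1) ^ k * poisson_tail a k) =
     exp (- a) * (\<Sum>k\<le>n. real (n choose k) * (- a) ^ k / fact k)"
proof -
  have "(\<Sum>k\<le>Suc n. real (Suc n choose k) * (-1) ^ k * poisson_tail a k) =
     (\<Sum>k\<le>Suc n. real (n choose k) * (-1) ^ k * poisson_tail a k) +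
     (\<Sum>k\<le>n. real (n choose k) * (-1) ^ Suc k * poisson_tail a (Suc k))"
    unfolding sum.atMost_Suc_shift by (simp add: algebra_simps sum.distrib sum_subtractf sum_negf)
  \<comment> \<open>The top term \<open>k = Suc n\<close> of the first sum vanishes because
    \<open>n choose Suc n = 0\<close>.\<close>
  also have "\<dots> = (\<Sum>k\<le>n. real (n choose k) * (-1) ^ k * (poisson_tail a k - poisson_tail a (Suc k)))"
    by (simp add: algebra_simps sum.distrib sum_negf sum_subtractf)
  also have "\<dots> = exp (- a) * (\<Sum>k\<le>n. real (n choose k) * (- a) ^ k / fact k)"
    unfolding sum_distrib_left
    by (intro sum.cong) (simp_all add: poisson_tail_def algebra_simps power_minus [of a])
  finally show ?thesis .
qed

text \<open>The point masses give \<open>exp (- a)\<close>, of which the Laguerre bound returns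
  \<open>exp (a / 2)\<close>. For \<open>n = 0\<close> the sum is 1, so positivity of
  \<open>n\<close> matters.\<close>

lemma abs_alternating_poisson_tail_sum_le:
  assumes "0 \<le> a" "0 < n"
  shows "\<bar>\<Sum>k\<le>n. real (n choose k) * (-1) ^ k * poisson_tail a k\<bar> \<le> exp (- a / 2)"
proof -
  obtain m where m: "n = Suc m" using assms by (cases n) auto
  have "\<bar>\<Sum>k\<le>n. real (n choose k) * (-1) ^ k * poisson_tail a k\<bar> \<le> exp (- a) * exp (a / 2)"
    unfolding m alternating_poisson_tail_sum abs_mult
    by (intro mult_mono abs_laguerre_le assms) auto
  also have "\<dots> = exp (- a / 2)" by (simp flip: exp_add)
  finally show ?thesis .
qed

section \<open>Chordal graphs\<close>

text \<open>The forbidden configuration of chordality for a bare relation, so that passing to an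
  induced subgraph only shrinks \<open>V\<close>.\<close>

definition has_induced_cycle :: "('a \<times> 'a) set \<Rightarrow> 'a set \<Rightarrow> bool" where
  "has_induced_cycle r V \<longleftrightarrow>
     (\<exists>k f. 4 \<le> k \<and> inj_on f {..<k} \<and> f ` {..<k} \<subseteq> V \<and>
        (\<forall>i<k. \<forall>j<k. (f i, f j) \<in> r \<longleftrightarrow> j = Suc i mod k \<or> i = Suc j mod k))"

lemma has_induced_cycle_mono: "has_induced_cycle r W \<Longrightarrow> W \<subseteq> V \<Longrightarrow> has_induced_cycle r V"
  unfolding has_induced_cycle_def by blast

text \<open>A walk of least length has no repeated vertex and no chord, as either would shorten
  it.\<close>

lemma shortest_path_induced:
  assumes "sym R" "irrefl R" "(x, y) \<in> R\<^sup>*"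
  obtains n f where "f 0 = x" "f n = y" "inj_on f {..n}"
    "\<And>i j. i \<le> n \<Longrightarrow> j \<le> n \<Longrightarrow> (f i, f j) \<in> R \<longleftrightarrow> j = Suc i \<or> i = Suc j"
proof -
  define n where "n = (LEAST n. (x, y) \<in> R ^^ n)"
  from assms(3) obtain m where "(x, y) \<in> R ^^ m" by (auto simp: rtrancl_power)
  then have "(x, y) \<in> R ^^ n" unfolding n_def by (rule LeastI)
  then obtain f where f: "f 0 = x" "f n = y" "\<And>i. i < n \<Longrightarrow> (f i, f (Suc i)) \<in> R"
    by (auto simp: relpow_fun_conv)
  have seg: "(f i, f (i + l)) \<in> R ^^ l" if "i + l \<le> n" for i l
    using that f(3) by (auto simp: relpow_fun_conv intro!: exI [of _ "\<lambda>m. f (i + m)"])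
  \<comment> \<open>Splice an \<open>l\<close>-step walk in place of the segment from
    \<open>i\<close> to \<open>j\<close> and compare with the minimal \<open>n\<close>. The case
    \<open>l = 0\<close> yields injectivity, \<open>l = 1\<close> the absence of chords.\<close>
  have short: "j \<le> i + l" if "i \<le> j" "j \<le> n" "(f i, f j) \<in> R ^^ l" for i j l
  proof -
    have "(x, f i) \<in> R ^^ i" using seg [of 0 i] that f by simp
    moreover have "(f j, y) \<in> R ^^ (n - j)" using seg [of j "n - j"] that f by simp
    ultimately have "(x, y) \<in> R ^^ (i + l + (n - j))"
      using that(3) by (auto simp: relpow_add)
    then have "n \<le> i + l + (n - j)" unfolding n_def by (rule Least_le)
    then show ?thesis using that by simp
  qed
  have inj: "inj_on f {..n}"
  proof (rule linorder_inj_onI)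
    fix i j assume "i < j" "i \<in> {..n}" "j \<in> {..n}"
    then show "f i \<noteq> f j" using short [of i j 0] by auto
  qed auto
  have fwd: "j = Suc i" if "i \<le> j" "j \<le> n" "(f i, f j) \<in> R" for i j
  proof -
    have "j \<le> Suc i" using short [of i j 1] that by simp
    moreover have "i \<noteq> j" using that assms(2) by (auto simp: irrefl_def)
    ultimately show ?thesis using that by simp
  qed
  have "(f i, f j) \<in> R \<longleftrightarrow> j = Suc i \<or> i = Suc j" if "i \<le> n" "j \<le> n" for i j
  proof
    assume "(f i, f j) \<in> R"
    moreover then have "(f j, f i) \<in> R" using \<open>sym R\<close> by (blast dest: symD)
    ultimately show "j = Suc i \<or> i = Suc j" using fwd [of i j] fwd [of j i] that by linarith
  next
    assume "j = Suc i \<or> i = Suc j"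
    then show "(f i, f j) \<in> R" using f(3) \<open>sym R\<close> that by (metis Suc_le_lessD symD)
  qed
  with f inj show thesis by (intro that)
qed

text \<open>A shortest path from \<open>y\<close> to \<open>y'\<close> through \<open>X\<close> is
  induced, and \<open>z\<close> closes it to an induced cycle, since it sees the two ends but
  nothing in \<open>X\<close>.\<close>

lemma induced_cycle_through_connected_set:
  assumes "sym r" "irrefl r"
    and conn: "\<And>u v. u \<in> X \<Longrightarrow> v \<in> X \<Longrightarrow> (u, v) \<in> (r \<inter> X \<times> X)\<^sup>*"
    and y: "x \<in> X" "(y, x) \<in> r" and y': "x' \<in> X" "(y', x') \<in> r"
    and ny: "y \<noteq> y'" "(y, y') \<notin> r"
    and z: "(z, y) \<in> r" "(z, y') \<in> r" "z \<notin> X" "\<And>u. u \<in> X \<Longrightarrow> (z, u) \<notin> r"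
    and V: "X \<subseteq> V" "y \<in> V" "y' \<in> V" "z \<in> V"
  shows "has_induced_cycle r V"
proof -
  define X' where "X' = insert y (insert y' X)"
  define R where "R = r \<inter> X' \<times> X'"
  have R: "sym R" "irrefl R"
    using assms(1,2) by (auto simp: R_def sym_def irrefl_def)
  have "(y, x) \<in> R" "(x', y') \<in> R"
    using y y' \<open>sym r\<close> by (auto simp: R_def X'_def dest: symD)
  moreover have "(x, x') \<in> R\<^sup>*"
    using conn [OF y(1) y'(1)] rtrancl_mono [of "r \<inter> X \<times> X" R] by (auto simp: R_def X'_def)
  ultimately have "(y, y') \<in> R\<^sup>*"
    by (meson converse_rtrancl_into_rtrancl rtrancl_into_rtrancl)
  with R obtain n f where f: "f 0 = y" "f n = y'" "inj_on f {..n}"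
    and adj: "\<And>i j. i \<le> n \<Longrightarrow> j \<le> n \<Longrightarrow> (f i, f j) \<in> R \<longleftrightarrow> j = Suc i \<or> i = Suc j"
    by (rule shortest_path_induced) blast
  \<comment> \<open>The ends are distinct and nonadjacent, so the path has at least two edges and
    the closed cycle at least four vertices.\<close>
  have "n \<noteq> 0" using f(1,2) ny(1) by metis
  moreover have "n \<noteq> 1" using adj [of 0 1] f ny by (auto simp: R_def)
  ultimately have n: "2 \<le> n" by simp
  have fX': "f i \<in> X'" if "i \<le> n" for i
  proof (cases "i = n")
    case True
    then show ?thesis using f by (simp add: X'_def)
  next
    case False
    then show ?thesis using adj [of i "Suc i"] that by (auto simp: R_def)
  qed
  \<comment> \<open>By injectivity, inner vertices differ from both ends.\<close>
  have fX: "f i \<in> X" if "0 < i" "i < n" for i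
    using fX' [of i] that f inj_onD [OF f(3), of i 0] inj_onD [OF f(3), of i n]
    by (auto simp: X'_def)
  have zX': "z \<notin> X'" using z \<open>irrefl r\<close> by (auto simp: X'_def irrefl_def) 
  have zadj: "(z, f i) \<in> r \<longleftrightarrow> i = 0 \<or> i = n" if "i \<le> n" for i
    using that fX [of i] z f by (cases "i = 0 \<or> i = n") auto
  define g where "g i = (if i \<le> n then f i else z)" for i
  define k where "k = n + 2"
  have "inj_on g {..<k}"
  proof (rule linorder_inj_onI)
    fix i j assume "i < j" "i \<in> {..<k}" "j \<in> {..<k}"
    then show "g i \<noteq> g j"
      using inj_onD [OF f(3), of i j] fX' [of i] zX' by (auto simp: g_def k_def)
  qed auto
  moreover have "g ` {..<k} \<subseteq> V"
    using fX' V by (auto simp: g_def X'_def)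
  moreover have "(g i, g j) \<in> r \<longleftrightarrow> j = Suc i mod k \<or> i = Suc j mod k" if "i < k" "j < k" for i j
  proof -
    consider "i \<le> n" "j \<le> n" | "i \<le> n" "j = Suc n" | "i = Suc n" "j \<le> n" | "i = Suc n" "j = Suc n"
      using \<open>i < k\<close> \<open>j < k\<close> by (force simp: k_def)
    then show ?thesis
    proof cases
      case 1
      then have "(g i, g j) \<in> r \<longleftrightarrow> (f i, f j) \<in> R" using fX' by (simp add: g_def R_def)
      then show ?thesis using adj [OF 1] 1 by (simp add: k_def)
    next
      case 2
      have "(g i, g j) \<in> r \<longleftrightarrow> (z, f i) \<in> r" using 2 \<open>sym r\<close> by (auto simp: g_def dest: symD)
      then show ?thesis using zadj [OF 2(1)] 2 by (auto simp: k_def)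
    next
      case 3
      have "(g i, g j) \<in> r \<longleftrightarrow> (z, f j) \<in> r" using 3 by (auto simp: g_def)
      then show ?thesis using zadj [OF 3(2)] 3 by (auto simp: k_def)
    next
      case 4
      then show ?thesis using \<open>irrefl r\<close> by (simp add: g_def irrefl_def k_def)
    qed
  qed
  ultimately show ?thesis
    unfolding has_induced_cycle_def using n by (intro exI [of _ k] exI [of _ g]) (simp add: k_def)
qed

text \<open>Take a maximal connected \<open>X\<close> whose closed neighbourhood is not all of \<open>V\<close>, let \<open>B\<close> be its boundary and
  \<open>W\<close> the rest. Maximality makes \<open>B\<close> complete to \<open>W\<close>, and the absence of induced cycles makes \<open>B\<close> a clique,
  so a simplicial vertex of \<open>W\<close> is simplicial in \<open>V\<close>.\<close>

lemma simplicial_vertex_exists: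
  assumes "finite V" "V \<noteq> {}" "sym r" "irrefl r" "\<not> has_induced_cycle r V"
  shows "\<exists>z\<in>V. \<forall>x\<in>V. \<forall>y\<in>V. (z, x) \<in> r \<longrightarrow> (z, y) \<in> r \<longrightarrow> x \<noteq> y \<longrightarrow> (x, y) \<in> r"
  using assms(1,2,5)
proof (induction V rule: finite_psubset_induct)
  case (psubset V)
  define N where "N X = X \<union> {v \<in> V. \<exists>x\<in>X. (x, v) \<in> r}" for X
  define good where "good X \<longleftrightarrow> X \<subseteq> V \<and> X \<noteq> {} \<and> N X \<noteq> V \<and>
    (\<forall>u\<in>X. \<forall>v\<in>X. (u, v) \<in> (r \<inter> X \<times> X)\<^sup>*)" for X
  show ?case
  proof (cases "\<exists>X. good X")
    case False
    \<comment> \<open>Otherwise the singleton would be good. Hence the graph is complete and any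
      vertex is simplicial.\<close>
    have univ: "N {v} = V" if "v \<in> V" for v
    proof -
      have "\<not> good {v}" using False by blast
      then show ?thesis using that by (simp add: good_def)
    qed
    have "(x, y) \<in> r" if "x \<in> V" "y \<in> V" "x \<noteq> y" for x y
    proof -
      have "y \<in> N {x}" using univ that by simp
      then show ?thesis using that by (simp add: N_def)
    qed
    moreover obtain z where "z \<in> V" using psubset.prems(1) by auto
    ultimately show ?thesis by (intro bexI [of _ z]) auto
  next
    case True
    have "finite (Collect good)"
        by (rule finite_subset [of _ "Pow V"]) (use psubset.hyps in \<open>auto simp: good_def\<close>)
    from finite_has_maximal [OF this] True obtain X where X: "good X"
      and max: "\<And>Y. good Y \<Longrightarrow> X \<subseteq> Y \<Longrightarrow> X = Y" by auto
    have XV: "X \<subseteq> V" and conn: "\<And>u v. u \<in> X \<Longrightarrow> v \<in> X \<Longrightarrow> (u, v) \<in> (r \<inter> X \<times> X)\<^sup>*"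
      using X by (auto simp: good_def)
    define B where "B = {v \<in> V - X. \<exists>x\<in>X. (x, v) \<in> r}"
    define W where "W = V - X - B"
    have W: "W \<subset> V" "W \<noteq> {}" using X by (auto simp: W_def B_def good_def N_def)
    have XW: "(x, w) \<notin> r" "(w, x) \<notin> r" if "x \<in> X" "w \<in> W" for x w
      using that \<open>sym r\<close> by (auto simp: W_def B_def dest: symD)
    have BW: "(b, w) \<in> r" if b: "b \<in> B" and w: "w \<in> W" for b w
    proof -
      obtain x where x: "x \<in> X" "(x, b) \<in> r" using b by (auto simp: B_def)
      \<comment> \<open>Enlarging \<open>X\<close> by \<open>b\<close> keeps it connected, so
        maximality forces its closed neighbourhood to be all of \<open>V\<close>. Then
        \<open>w\<close> has a neighbour in \<open>Y\<close>, and it can only be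
        \<open>b\<close>.\<close>
      define Y where "Y = insert b X"
      let ?Y = "(r \<inter> Y \<times> Y)\<^sup>*"
      have XY: "(u, v) \<in> ?Y" if "u \<in> X" "v \<in> X" for u v
        using conn [OF that] rtrancl_mono [of "r \<inter> X \<times> X" "r \<inter> Y \<times> Y"] by (auto simp: Y_def)
      have "(b, x) \<in> r" using x \<open>sym r\<close> by (blast dest: symD)
      then have "(x, b) \<in> ?Y" "(b, x) \<in> ?Y"
        using x by (simp_all add: Y_def r_into_rtrancl)
      then have "\<forall>u\<in>Y. (u, x) \<in> ?Y \<and> (x, u) \<in> ?Y"
        using XY x(1) by (simp add: Y_def)
      then have "\<forall>u\<in>Y. \<forall>v\<in>Y. (u, v) \<in> ?Y" by (meson rtrancl_trans)
      moreover have "\<not> good Y"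
      proof
        assume "good Y"
        then have "X = Y" using max by (auto simp: Y_def)
        then show False using b by (auto simp: Y_def B_def)
      qed
      moreover have "Y \<subseteq> V" "Y \<noteq> {}" using b XV by (auto simp: Y_def B_def)
      ultimately have "N Y = V" unfolding good_def by blast
      then have "w \<in> N Y" "w \<notin> Y" using w b by (auto simp: W_def Y_def)
      then obtain y where "y \<in> Y" "(y, w) \<in> r" by (auto simp: N_def)
      then show ?thesis using XW w by (auto simp: Y_def)
    qed
    have Bclique: "(b, c) \<in> r" if bc: "b \<in> B" "c \<in> B" "b \<noteq> c" for b c
    proof (rule ccontr)
      assume "(b, c) \<notin> r"
      obtain w where w: "w \<in> W" using W by blast
      have nbr: "\<exists>x\<in>X. (v, x) \<in> r" if "v \<in> B" for v
        using that \<open>sym r\<close> unfolding B_def by (blast dest: symD)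
      obtain x where x: "x \<in> X" "(b, x) \<in> r" using nbr bc(1) by blast
      obtain x' where x': "x' \<in> X" "(c, x') \<in> r" using nbr bc(2) by blast
      have "(w, b) \<in> r" "(w, c) \<in> r" using BW bc w \<open>sym r\<close> by (blast dest: symD)+
      moreover have "w \<notin> X" "b \<in> V" "c \<in> V" "w \<in> V" using bc w by (auto simp: W_def B_def)
      ultimately have "has_induced_cycle r V"
        using induced_cycle_through_connected_set [OF assms(3,4) conn x x' bc(3) \<open>(b, c) \<notin> r\<close>]
          XW(2) [OF _ w] XV by blast
      then show False using psubset.prems by blast
    qed
    have "\<not> has_induced_cycle r W"
      using psubset.prems(2) W has_induced_cycle_mono by blast
    then obtain z where z: "z \<in> W"
      "\<And>x y. \<lbrakk>x \<in> W; y \<in> W; (z, x) \<in> r; (z, y) \<in> r; x \<noteq> y\<rbrakk> \<Longrightarrow> (x, y) \<in> r"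
      using psubset.IH [OF W] by blast
    \<comment> \<open>Neighbours of \<open>z\<close> avoid \<open>X\<close>. Pairs inside
      \<open>W\<close> are covered by the choice of \<open>z\<close>, mixed pairs by
      \<open>BW\<close>, pairs inside \<open>B\<close> by \<open>Bclique\<close>.\<close>
    have "(x, y) \<in> r" if "x \<in> V" "y \<in> V" "(z, x) \<in> r" "(z, y) \<in> r" "x \<noteq> y" for x y
    proof -
      have "x \<in> W \<union> B" "y \<in> W \<union> B" using that z XW by (auto simp: W_def)
      then show ?thesis using that z BW Bclique \<open>sym r\<close> by (blast dest: symD)
    qed
    then show ?thesis using z W by blast
  qed
qed

section \<open>Components and cliques when a simplicial vertex is added\<close>

definition reach_classes :: "('a \<times> 'a) set \<Rightarrow> 'a set \<Rightarrow> 'a set set" where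
  "reach_classes r W = (\<lambda>v. {u \<in> W. (v, u) \<in> (r \<inter> W \<times> W)\<^sup>*}) ` W"

text \<open>A walk enters and leaves \<open>z\<close> through vertices that are equal or adjacent,
  so the detour can be cut out. The case \<open>v = z\<close> is the induction invariant while the
  walk sits at \<open>z\<close>: it remembers a neighbour of \<open>z\<close> reached inside
  \<open>W\<close>.\<close>

lemma rtrancl_insert_simplicial:
  assumes P: "\<And>x y. \<lbrakk>x \<in> W; y \<in> W; (z, x) \<in> r; (z, y) \<in> r; x \<noteq> y\<rbrakk> \<Longrightarrow> (x, y) \<in> r"
    and "sym r" "irrefl r" "u \<in> W" "z \<notin> W"
    and path: "(u, v) \<in> (r \<inter> insert z W \<times> insert z W)\<^sup>*"
  shows "if v = z then \<exists>y\<in>W. (z, y) \<in> r \<and> (u, y) \<in> (r \<inter> W \<times> W)\<^sup>* else (u, v) \<in> (r \<inter> W \<times> W)\<^sup>*"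
  using path
proof (induction rule: rtrancl_induct)
  case base
  then show ?case using assms by auto
next
  case (step v w)
  then have vw: "(v, w) \<in> r" "v \<in> insert z W" "w \<in> insert z W" by auto
  then have "v \<noteq> w" using \<open>irrefl r\<close> by (auto simp: irrefl_def)
  show ?case
  proof (cases "v = z")
    case True
    with step.IH obtain y where y: "y \<in> W" "(z, y) \<in> r" "(u, y) \<in> (r \<inter> W \<times> W)\<^sup>*" by auto
    have "w \<in> W" "(z, w) \<in> r" using vw True \<open>v \<noteq> w\<close> by auto
    then have "y = w \<or> (y, w) \<in> r \<inter> W \<times> W" using P y by blast
    then have "(u, w) \<in> (r \<inter> W \<times> W)\<^sup>*" using y by (auto intro: rtrancl_into_rtrancl)
    then show ?thesis using \<open>w \<in> W\<close> \<open>z \<notin> W\<close> by auto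
  next
    case v: False
    then have uv: "(u, v) \<in> (r \<inter> W \<times> W)\<^sup>*" "v \<in> W" using step.IH vw by auto
    show ?thesis
    proof (cases "w = z")
      case True
      then show ?thesis using uv vw \<open>sym r\<close> by (auto dest: symD)
    next
      case False
      then show ?thesis using uv vw by (auto intro: rtrancl_into_rtrancl)
    qed
  qed
qed

text \<open>Classes inside \<open>W\<close> and inside \<open>insert z W\<close> differ as sets;
  this compares their number through the equivalence relation alone.\<close>

lemma card_image_cong_kernel:
  assumes "\<And>u v. u \<in> A \<Longrightarrow> v \<in> A \<Longrightarrow> f u = f v \<longleftrightarrow> g u = g v"
  shows "card (f ` A) = card (g ` A)"
proof -
  define h where "h y = g (inv_into A f y)" for y
  have h: "h (f u) = g u" if "u \<in> A" for u
  proof -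
    have "f (inv_into A f (f u)) = f u" "inv_into A f (f u) \<in> A"
      using that by (auto intro: f_inv_into_f inv_into_into)
    then show ?thesis using assms that by (simp add: h_def)
  qed
  have "inj_on h (f ` A)"
    by (rule inj_onI) (use assms h in auto)
  moreover have "h ` f ` A = g ` A" using h by (auto simp: image_image)
  ultimately show ?thesis by (metis card_image)
qed

text \<open>An isolated \<open>z\<close> opens a new component. Otherwise it joins that of a
  neighbour, and being simplicial it merges no two old components.\<close>

lemma card_reach_classes_insert_simplicial:
  assumes P: "\<And>x y. \<lbrakk>x \<in> W; y \<in> W; (z, x) \<in> r; (z, y) \<in> r; x \<noteq> y\<rbrakk> \<Longrightarrow> (x, y) \<in> r"
    and "sym r" "irrefl r" "finite W" "z \<notin> W"
  shows "card (reach_classes r (insert z W)) =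
    card (reach_classes r W) + (if {x \<in> W. (z, x) \<in> r} = {} then 1 else 0)"
proof -
  let ?W = "insert z W"
  define F where "F v = {u \<in> ?W. (v, u) \<in> (r \<inter> ?W \<times> ?W)\<^sup>*}" for v
  define G where "G v = {u \<in> W. (v, u) \<in> (r \<inter> W \<times> W)\<^sup>*}" for v
  have reach: "(u, v) \<in> (r \<inter> ?W \<times> ?W)\<^sup>* \<longleftrightarrow> (u, v) \<in> (r \<inter> W \<times> W)\<^sup>*" if "u \<in> W" "v \<in> W" for u v
  proof
    assume "(u, v) \<in> (r \<inter> ?W \<times> ?W)\<^sup>*"
    from rtrancl_insert_simplicial [OF P assms(2,3) \<open>u \<in> W\<close> assms(5) this]
    show "(u, v) \<in> (r \<inter> W \<times> W)\<^sup>*" using that assms(5) by (auto split: if_splits)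
  next
    assume "(u, v) \<in> (r \<inter> W \<times> W)\<^sup>*"
    then show "(u, v) \<in> (r \<inter> ?W \<times> ?W)\<^sup>*"
      using rtrancl_mono [of "r \<inter> W \<times> W" "r \<inter> ?W \<times> ?W"] by blast
  qed
  have sym_star: "sym ((r \<inter> A \<times> A)\<^sup>*)" for A
    using \<open>sym r\<close> by (intro sym_rtrancl) (auto simp: sym_def)
  have F_eq: "F u = F v \<longleftrightarrow> (u, v) \<in> (r \<inter> ?W \<times> ?W)\<^sup>*" if "u \<in> ?W" "v \<in> ?W" for u v
    using that symD [OF sym_star [of ?W]] unfolding F_def
    by (auto intro: rtrancl_trans)
  have G_eq: "G u = G v \<longleftrightarrow> (u, v) \<in> (r \<inter> W \<times> W)\<^sup>*" if "u \<in> W" "v \<in> W" for u v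
    using that symD [OF sym_star [of W]] unfolding G_def
    by (auto intro: rtrancl_trans)
  have FG: "card (F ` W) = card (G ` W)"
    by (rule card_image_cong_kernel) (simp only: F_eq G_eq reach insertI2)
  have "card (F ` ?W) = card (G ` W) + (if {x \<in> W. (z, x) \<in> r} = {} then 1 else 0)"
  proof (cases "{x \<in> W. (z, x) \<in> r} = {}")
    case True
    have "F z \<notin> F ` W"
    proof
      assume "F z \<in> F ` W"
      then obtain u where "u \<in> W" "(u, z) \<in> (r \<inter> ?W \<times> ?W)\<^sup>*" using F_eq by auto
      from rtrancl_insert_simplicial [OF P assms(2,3) this(1) assms(5) this(2)] True
      show False by auto
    qed
    then show ?thesis using True FG \<open>finite W\<close> by simp
  next
    case False
    then obtain x where x: "x \<in> W" "(z, x) \<in> r" by blast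
    then have "F z = F x" using F_eq [of z x] by auto
    then have "F ` ?W = F ` W" using x by auto
    then show ?thesis using FG False by simp
  qed
  then show ?thesis unfolding reach_classes_def F_def G_def .
qed

text \<open>The empty set is excluded so that each clique has a first eliminated vertex.\<close>

definition cliques :: "('a \<times> 'a) set \<Rightarrow> 'a set \<Rightarrow> 'a set set" where
  "cliques r S = {A. A \<subseteq> S \<and> finite A \<and> A \<noteq> {} \<and> (\<forall>x\<in>A. \<forall>y\<in>A. x \<noteq> y \<longrightarrow> (x, y) \<in> r)}"

text \<open>The neighbourhood of \<open>z\<close> is a clique, so the cliques through
  \<open>z\<close> correspond to arbitrary subsets \<open>B\<close> of it and have one element more
  than \<open>B\<close>.\<close>

lemma sum_cliques_insert_simplicial:
  fixes u :: "nat \<Rightarrow> 'b::comm_monoid_add"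
  assumes P: "\<And>x y. \<lbrakk>x \<in> S; y \<in> S; (z, x) \<in> r; (z, y) \<in> r; x \<noteq> y\<rbrakk> \<Longrightarrow> (x, y) \<in> r"
    and "sym r" "finite S" "z \<notin> S"
  shows "(\<Sum>A\<in>cliques r (insert z S). u (card A)) =
    (\<Sum>A\<in>cliques r S. u (card A)) + (\<Sum>B\<in>Pow {x \<in> S. (z, x) \<in> r}. u (Suc (card B)))"
proof -
  let ?N = "{x \<in> S. (z, x) \<in> r}"
  have fin: "finite (cliques r S)"
    by (rule finite_subset [of _ "Pow S"]) (use assms in \<open>auto simp: cliques_def\<close>)
  have "cliques r (insert z S) = cliques r S \<union> insert z ` Pow ?N"
  proof (intro equalityI subsetI)
    fix A assume A: "A \<in> cliques r (insert z S)"
    show "A \<in> cliques r S \<union> insert z ` Pow ?N"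
    proof (cases "z \<in> A")
      case True
      have "A \<subseteq> insert z S" "\<And>x. x \<in> A \<Longrightarrow> z \<noteq> x \<Longrightarrow> (z, x) \<in> r"
        using A True unfolding cliques_def by blast+
      then have "A - {z} \<subseteq> ?N" by auto
      then have "A \<in> insert z ` Pow ?N"
        using True by (intro image_eqI [of _ _ "A - {z}"]) (simp_all add: insert_absorb)
      then show ?thesis ..
    next
      case False
      then have "A \<subseteq> S" using A by (auto simp only: cliques_def)
      then show ?thesis using A by (simp add: cliques_def)
    qed
  next
    fix A assume "A \<in> cliques r S \<union> insert z ` Pow ?N"
    then show "A \<in> cliques r (insert z S)"
    proof
      assume "A \<in> cliques r S"
      then show ?thesis unfolding cliques_def by blast
    next
      assume "A \<in> insert z ` Pow ?N"
      then obtain B where B: "B \<subseteq> ?N" "A = insert z B" by blast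
      then have "finite A" using \<open>finite S\<close> finite_subset [of B S] by auto
      moreover have "(x, y) \<in> r" if "x \<in> A" "y \<in> A" "x \<noteq> y" for x y
        using that B P [of x y] symD [OF \<open>sym r\<close>] by auto
      ultimately show ?thesis using B unfolding cliques_def by blast
    qed
  qed
  moreover have "cliques r S \<inter> insert z ` Pow ?N = {}"
    using \<open>z \<notin> S\<close> by (auto simp only: cliques_def)
  moreover have inj: "inj_on (insert z) (Pow ?N)"
    using \<open>z \<notin> S\<close> by (auto simp: inj_on_def insert_eq_iff)
  moreover have "card (insert z B) = Suc (card B)" if "B \<in> Pow ?N" for B
    using that \<open>z \<notin> S\<close> \<open>finite S\<close> by (subst card_insert_disjoint) (auto intro: finite_subset)
  ultimately show ?thesis
    using fin \<open>finite S\<close> by (simp add: sum.union_disjoint sum.reindex)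
qed

section \<open>Perfect elimination orderings\<close>

text \<open>Keeps three consequences of a perfect elimination ordering in place of the ordering
  itself; \<open>P v\<close> stands for the later neighbours of \<open>v\<close>. The clique
  identity is required for every \<open>S\<close>, because the sample is arbitrary.\<close>

definition parent_map :: "('a \<times> 'a) set \<Rightarrow> 'a set \<Rightarrow> ('a \<Rightarrow> 'a set) \<Rightarrow> bool" where
  "parent_map r V P \<longleftrightarrow>
    (\<forall>v\<in>V. P v \<subseteq> {x \<in> V. (v, x) \<in> r}) \<and>
    card (reach_classes r V) = card {v \<in> V. P v = {}} \<and>
    (\<forall>S u. S \<subseteq> V \<longrightarrow> (\<Sum>A\<in>cliques r S. u (card A) :: real) =
       (\<Sum>v\<in>S. \<Sum>B\<in>Pow (P v \<inter> S). u (Suc (card B))))"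

text \<open>Eliminate a simplicial vertex \<open>z\<close> first: its parents are all its
  neighbours, and the map on the remaining vertices is unchanged.\<close>

lemma parent_map_exists:
  assumes "finite V" "sym r" "irrefl r" "\<not> has_induced_cycle r V"
  shows "\<exists>P. parent_map r V P"
  using assms(1,4)
proof (induction "card V" arbitrary: V)
  case 0
  then have "V = {}" by simp
  then show ?case by (auto simp: parent_map_def reach_classes_def cliques_def)
next
  case (Suc m)
  then have "V \<noteq> {}" by auto
  from simplicial_vertex_exists [OF Suc.prems(1) this assms(2,3) Suc.prems(2)]
  obtain z where z: "z \<in> V"
    and zP: "\<And>x y. \<lbrakk>x \<in> V; y \<in> V; (z, x) \<in> r; (z, y) \<in> r; x \<noteq> y\<rbrakk> \<Longrightarrow> (x, y) \<in> r" by blast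
  define W where "W = V - {z}"
  have V: "V = insert z W" "z \<notin> W" "finite W" using z Suc.prems by (auto simp: W_def)
  have "m = card W" using Suc.hyps(2) V by simp
  moreover have "\<not> has_induced_cycle r W"
    using Suc.prems(2) has_induced_cycle_mono [of r W V] V by blast
  ultimately obtain P where "parent_map r W P"
    using Suc.hyps(1) [OF _ \<open>finite W\<close>] by blast
  then have P: "\<And>v. v \<in> W \<Longrightarrow> P v \<subseteq> {x \<in> W. (v, x) \<in> r}"
    "card (reach_classes r W) = card {v \<in> W. P v = {}}"
    "\<And>S u. S \<subseteq> W \<Longrightarrow> (\<Sum>A\<in>cliques r S. u (card A) :: real) =
       (\<Sum>v\<in>S. \<Sum>B\<in>Pow (P v \<inter> S). u (Suc (card B)))"
    by (simp_all add: parent_map_def)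
  define N where "N = {x \<in> W. (z, x) \<in> r}"
  define Q where "Q = P(z := N)"
  have QP: "Q v = P v" if "v \<in> W" for v using that V by (auto simp: Q_def)
  have Qz: "Q z = N" by (simp add: Q_def)
  have "Q v \<subseteq> {x \<in> V. (v, x) \<in> r}" if "v \<in> V" for v
    using that P(1) V by (auto simp: Q_def N_def split: if_splits)
  moreover have "card (reach_classes r V) = card {v \<in> V. Q v = {}}"
  proof -
    have "{v \<in> V. Q v = {}} = {v \<in> W. P v = {}} \<union> (if N = {} then {z} else {})"
      using V QP Qz by auto
    then have "card {v \<in> V. Q v = {}} = card {v \<in> W. P v = {}} + (if N = {} then 1 else 0)"
      using V by auto
    moreover have "card (reach_classes r V) = card (reach_classes r W) + (if N = {} then 1 else 0)"
      unfolding V(1) N_def using zP V assms(2,3) by (intro card_reach_classes_insert_simplicial) auto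
    ultimately show ?thesis using P(2) by simp
  qed
  moreover have "(\<Sum>A\<in>cliques r S. u (card A) :: real) =
       (\<Sum>v\<in>S. \<Sum>B\<in>Pow (Q v \<inter> S). u (Suc (card B)))" if S: "S \<subseteq> V" for S u
  proof (cases "z \<in> S")
    case False
    then have "S \<subseteq> W" using S V by auto
    then show ?thesis using P(3) [of S u] QP by (auto intro!: sum.cong)
  next
    case True
    define S' where "S' = S - {z}"
    have S': "S = insert z S'" "z \<notin> S'" "S' \<subseteq> W" "finite S'"
      using True S V by (auto simp: S'_def intro: finite_subset)
    have 1: "Q z \<inter> S = {x \<in> S'. (z, x) \<in> r}"
      using S' V by (auto simp: Qz N_def)
    \<comment> \<open>The vertex \<open>z\<close> is eliminated first, so it is nobody's
      parent.\<close>
    have 2: "Q v \<inter> S = P v \<inter> S'" if "v \<in> S'" for v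
      using that S' P(1) [of v] V QP [of v] by auto
    have "(\<Sum>A\<in>cliques r S. u (card A) :: real) =
      (\<Sum>A\<in>cliques r S'. u (card A)) + (\<Sum>B\<in>Pow {x \<in> S'. (z, x) \<in> r}. u (Suc (card B)))"
      unfolding S'(1) using zP S' V assms(2) by (intro sum_cliques_insert_simplicial) auto
    also have "\<dots> = (\<Sum>B\<in>Pow (Q z \<inter> S). u (Suc (card B))) +
       (\<Sum>v\<in>S'. \<Sum>B\<in>Pow (Q v \<inter> S). u (Suc (card B)))"
      unfolding 1 P(3) [OF S'(3)] using 2 by simp
    also have "\<dots> = (\<Sum>v\<in>S. \<Sum>B\<in>Pow (Q v \<inter> S). u (Suc (card B)))"
      using S' by (subst (2) S'(1)) (subst sum.insert, auto)
    finally show ?thesis .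
  qed
  ultimately have "parent_map r V Q" by (simp add: parent_map_def)
  then show ?case by blast
qed

section \<open>Bernoulli sampling\<close>

lemma set_pmf_bernoulli_subset: "set_pmf (bernoulli_subset A p) \<subseteq> Pow A"
  by (auto simp: bernoulli_subset_def)

lemma finite_set_pmf_bernoulli_subset: "finite A \<Longrightarrow> finite (set_pmf (bernoulli_subset A p))"
  by (rule finite_subset [OF set_pmf_bernoulli_subset]) simp

lemma integrable_bernoulli_subset:
  fixes f :: "'a set \<Rightarrow> real"
  shows "finite A \<Longrightarrow> integrable (bernoulli_subset A p) f"
  by (intro integrable_measure_pmf_finite finite_set_pmf_bernoulli_subset)

abbreviation expect :: "'a set \<Rightarrow> real \<Rightarrow> ('a set \<Rightarrow> real) \<Rightarrow> real" where
  "expect A p f \<equiv> measure_pmf.expectation (bernoulli_subset A p) f"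

lemma expect_cong:
  "(\<And>S. S \<subseteq> A \<Longrightarrow> f S = g S) \<Longrightarrow> expect A p f = expect A p g"
  using set_pmf_bernoulli_subset [of A p] by (intro integral_cong_AE) (auto simp: AE_measure_pmf_iff)

lemma expect_mono:
  assumes "finite A" "\<And>S. S \<subseteq> A \<Longrightarrow> f S \<le> g S"
  shows "expect A p f \<le> expect A p g"
  using set_pmf_bernoulli_subset [of A p] assms
  by (intro integral_mono_AE integrable_bernoulli_subset) (auto simp: AE_measure_pmf_iff)

lemma bernoulli_subset_insert:
  assumes "finite A" "x \<notin> A"
  shows "bernoulli_subset (insert x A) p =
    bind_pmf (bernoulli_pmf p) (\<lambda>b. map_pmf (\<lambda>S. if b then insert x S else S) (bernoulli_subset A p))"
proof -
  have "{v \<in> insert x A. (f(x := b)) v} = (if b then insert x {v \<in> A. f v} else {v \<in> A. f v})" for f b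
    using \<open>x \<notin> A\<close> by auto
  then show ?thesis
    unfolding bernoulli_subset_def
    by (simp add: Pi_pmf_insert' [OF assms] map_bind_pmf map_pmf_def bind_assoc_pmf bind_return_pmf)
qed

lemma expect_insert:
  assumes "finite A" "x \<notin> A" "0 \<le> p" "p \<le> 1"
  shows "expect (insert x A) p f = p * expect A p (\<lambda>S. f (insert x S)) + (1 - p) * expect A p f"
proof -
  have "expect (insert x A) p f =
     (\<Sum>b\<in>UNIV. pmf (bernoulli_pmf p) b *\<^sub>R
        measure_pmf.expectation (map_pmf (\<lambda>S. if b then insert x S else S) (bernoulli_subset A p)) f)"
    unfolding bernoulli_subset_insert [OF assms(1,2)]
    by (rule pmf_expectation_bind) (use finite_set_pmf_bernoulli_subset [OF assms(1)] in auto)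
  then show ?thesis using assms by (simp add: UNIV_bool)
qed

text \<open>Independence of the sample on disjoint sets, by exposing the elements of
  \<open>A\<close> one at a time. The function \<open>f\<close> is generalised because exposing
  \<open>x\<close> replaces it by \<open>f\<close> after \<open>insert x\<close>.\<close>

lemma expect_Int_times_Int:
  assumes "finite A" "finite B" "A \<inter> B = {}" "0 \<le> p" "p \<le> 1"
  shows "expect (A \<union> B) p (\<lambda>S. f (S \<inter> A) * g (S \<inter> B)) = expect A p f * expect B p g"
  using assms(1,3)
proof (induction A arbitrary: f rule: finite_induct)
  case empty
  have "expect B p (\<lambda>S. f {} * g (S \<inter> B)) = expect B p (\<lambda>S. f {} * g S)"
    by (rule expect_cong) (simp add: Int_absorb2)
  moreover have "expect {} p f = f {}" by (simp add: bernoulli_subset_def)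
  ultimately show ?case by simp
next
  case (insert x A)
  have x: "x \<notin> A \<union> B" "finite (A \<union> B)" "A \<inter> B = {}" using insert assms by auto
  have "expect (A \<union> B) p (\<lambda>S. f (insert x S \<inter> insert x A) * g (insert x S \<inter> B)) =
    expect (A \<union> B) p (\<lambda>S. f (insert x (S \<inter> A)) * g (S \<inter> B))"
    using x by (intro expect_cong) (auto intro!: arg_cong2 [where f = "(*)"] arg_cong [where f = f] arg_cong [where f = g])
  also have "\<dots> = expect A p (\<lambda>S. f (insert x S)) * expect B p g"
    using insert.IH [of "\<lambda>S. f (insert x S)"] x by simp
  finally have 1: "expect (A \<union> B) p (\<lambda>S. f (insert x S \<inter> insert x A) * g (insert x S \<inter> B)) =
    expect A p (\<lambda>S. f (insert x S)) * expect B p g" .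
  have "expect (A \<union> B) p (\<lambda>S. f (S \<inter> insert x A) * g (S \<inter> B)) =
    expect (A \<union> B) p (\<lambda>S. f (S \<inter> A) * g (S \<inter> B))"
    using x by (intro expect_cong) (auto intro!: arg_cong2 [where f = "(*)"] arg_cong [where f = f])
  also have "\<dots> = expect A p f * expect B p g" using insert.IH x by simp
  finally have 2: "expect (A \<union> B) p (\<lambda>S. f (S \<inter> insert x A) * g (S \<inter> B)) =
    expect A p f * expect B p g" .
  show ?case
    unfolding Un_insert_left expect_insert [OF x(2,1) assms(4,5)] 1 2
      expect_insert [OF insert.hyps assms(4,5)] by (simp add: algebra_simps)
qed

lemma expect_Int:
  assumes "finite V" "A \<subseteq> V" "0 \<le> p" "p \<le> 1"
  shows "expect V p (\<lambda>S. f (S \<inter> A)) = expect A p f"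
proof -
  have "finite A" "finite (V - A)" "A \<union> (V - A) = V" using assms by (auto intro: finite_subset)
  then show ?thesis
    using expect_Int_times_Int [of A "V - A" p f "\<lambda>_. 1"] assms by simp
qed

text \<open>Restrict the sample to \<open>A \<union> B\<close>, factor there, and read both factors
  as marginals of the sample on \<open>V\<close>.\<close>

lemma expect_Int_independent:
  assumes "finite V" "A \<subseteq> V" "B \<subseteq> V" "A \<inter> B = {}" "0 \<le> p" "p \<le> 1"
  shows "expect V p (\<lambda>S. f (S \<inter> A) * g (S \<inter> B)) =
    expect V p (\<lambda>S. f (S \<inter> A)) * expect V p (\<lambda>S. g (S \<inter> B))"
proof -
  have "finite A" "finite B" using assms by (auto intro: finite_subset)
  then have "expect (A \<union> B) p (\<lambda>S. f (S \<inter> A) * g (S \<inter> B)) = expect A p f * expect B p g"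
    using assms by (intro expect_Int_times_Int) auto
  moreover have "expect V p (\<lambda>S. f (S \<inter> (A \<union> B) \<inter> A) * g (S \<inter> (A \<union> B) \<inter> B)) =
     expect (A \<union> B) p (\<lambda>S. f (S \<inter> A) * g (S \<inter> B))"
    using assms by (intro expect_Int [where f = "\<lambda>S. f (S \<inter> A) * g (S \<inter> B)"]) auto
  moreover have "S \<inter> (A \<union> B) \<inter> A = S \<inter> A" "S \<inter> (A \<union> B) \<inter> B = S \<inter> B" for S by auto
  ultimately show ?thesis using assms by (simp add: expect_Int)
qed

lemma expect_card:
  assumes "finite A" "0 \<le> p" "p \<le> 1"
  shows "expect A p (\<lambda>S. g (card S)) =
    (\<Sum>k\<le>card A. real (card A choose k) * p ^ k * (1 - p) ^ (card A - k) * g k)"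
proof -
  have "expect A p (\<lambda>S. g (card S)) = measure_pmf.expectation (binomial_pmf (card A) p) g"
    using assms by (simp add: bernoulli_subset_def binomial_pmf_altdef' [OF assms(1) refl, of p False])
  then show ?thesis using assms by (simp add: expectation_binomial_pmf')
qed

text \<open>As \<open>v\<close> lies outside \<open>P\<close>, its inclusion is independent of the
  binomial count on \<open>P\<close>.\<close>

lemma expect_vertex_card:
  assumes "finite V" "v \<in> V" "P \<subseteq> V" "v \<notin> P" "0 \<le> p" "p \<le> 1"
  shows "expect V p (\<lambda>S. if v \<in> S then g (card (P \<inter> S)) else 0) =
    p * (\<Sum>k\<le>card P. real (card P choose k) * p ^ k * (1 - p) ^ (card P - k) * g k)"
proof -
  have P: "finite P" using assms by (auto intro: finite_subset)
  have "expect V p (\<lambda>S. if v \<in> S then g (card (P \<inter> S)) else 0) =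
     expect V p (\<lambda>S. (if v \<in> S \<inter> insert v P then g (card (P \<inter> (S \<inter> insert v P))) else 0))"
    by (intro expect_cong) (auto intro!: arg_cong [where f = "\<lambda>A. g (card A)"])
  also have "\<dots> = expect (insert v P) p (\<lambda>S. if v \<in> S then g (card (P \<inter> S)) else 0)"
    using assms by (intro expect_Int) auto
  also have "\<dots> = p * expect P p (\<lambda>S. g (card (P \<inter> S)))"
  proof -
    have "expect P p (\<lambda>S. if v \<in> S then g (card (P \<inter> S)) else 0) = expect P p (\<lambda>_. 0)"
      using assms(4) by (intro expect_cong) auto
    moreover have "P \<inter> insert v S = P \<inter> S" for S using assms(4) by auto
    ultimately show ?thesis using expect_insert [OF P assms(4-6)] by simp
  qed
  also have "expect P p (\<lambda>S. g (card (P \<inter> S))) = expect P p (\<lambda>S. g (card S))"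
    by (intro expect_cong) (simp add: Int_absorb1)
  finally show ?thesis by (simp add: expect_card [OF P assms(5,6)])
qed

text \<open>Second moment by pairs: disjoint supports give independence and a product of means, and
  each \<open>v\<close> has at most \<open>m\<close> partners with overlapping support.\<close>

lemma expect_square_sum_le:
  fixes Z :: "'a \<Rightarrow> 'a set \<Rightarrow> real"
  assumes "finite V" "0 \<le> p" "p \<le> 1"
    and D: "\<And>v. v \<in> V \<Longrightarrow> D v \<subseteq> V" "\<And>v S. v \<in> V \<Longrightarrow> Z v (S \<inter> D v) = Z v S"
    and bound: "\<And>v S. v \<in> V \<Longrightarrow> \<bar>Z v S\<bar> \<le> M"
    and mean: "\<And>v. v \<in> V \<Longrightarrow> \<bar>expect V p (Z v)\<bar> \<le> \<beta>"
    and deg: "\<And>v. v \<in> V \<Longrightarrow> card {w \<in> V. D v \<inter> D w \<noteq> {}} \<le> m"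
  shows "expect V p (\<lambda>S. (\<Sum>v\<in>V. Z v S)\<^sup>2) \<le> (real (card V))\<^sup>2 * \<beta>\<^sup>2 + real (card V) * real m * M\<^sup>2"
proof -
  \<comment> \<open>The term \<open>\<beta>\<^sup>2\<close> is granted to all pairs, which sums to a
    clean squared-bias term.\<close>
  have pair: "expect V p (\<lambda>S. Z v S * Z w S) \<le> \<beta>\<^sup>2 + (if D v \<inter> D w \<noteq> {} then M\<^sup>2 else 0)"
    if vw: "v \<in> V" "w \<in> V" for v w
  proof (cases "D v \<inter> D w = {}")
    case True
    have "expect V p (\<lambda>S. Z v S * Z w S) = expect V p (\<lambda>S. Z v (S \<inter> D v) * Z w (S \<inter> D w))"
      using D vw by simp
    also have "\<dots> = expect V p (Z v) * expect V p (Z w)"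
      using expect_Int_independent [of V "D v" "D w" p "Z v" "Z w"] assms True vw by simp
    also have "\<dots> \<le> \<bar>expect V p (Z v)\<bar> * \<bar>expect V p (Z w)\<bar>"
      by (metis abs_ge_self abs_mult)
    also have "\<dots> \<le> \<beta> * \<beta>"
      using mean [OF vw(1)] mean [OF vw(2)] by (intro mult_mono) auto
    finally show ?thesis using True by (simp add: power2_eq_square)
  next
    case False
    have "expect V p (\<lambda>S. Z v S * Z w S) \<le> expect V p (\<lambda>_. M\<^sup>2)"
    proof (rule expect_mono [OF assms(1)])
      fix S
      have "Z v S * Z w S \<le> \<bar>Z v S\<bar> * \<bar>Z w S\<bar>" by (metis abs_ge_self abs_mult)
      also have "\<dots> \<le> M * M" using bound [OF vw(1)] bound [OF vw(2)]
        by (intro mult_mono) (auto intro: order_trans [OF abs_ge_zero])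
      finally show "Z v S * Z w S \<le> M\<^sup>2" by (simp add: power2_eq_square)
    qed
    then show ?thesis using False by simp (smt (verit) zero_le_power2)
  qed
  have "expect V p (\<lambda>S. (\<Sum>v\<in>V. Z v S)\<^sup>2) = (\<Sum>v\<in>V. \<Sum>w\<in>V. expect V p (\<lambda>S. Z v S * Z w S))"
    using assms(1) by (simp add: power2_eq_square sum_product Bochner_Integration.integral_sum integrable_bernoulli_subset)
  also have "\<dots> \<le> (\<Sum>v\<in>V. \<Sum>w\<in>V. \<beta>\<^sup>2 + (if D v \<inter> D w \<noteq> {} then M\<^sup>2 else 0))"
    by (intro sum_mono pair)
  also have "\<dots> = (\<Sum>v\<in>V. real (card V) * \<beta>\<^sup>2 + real (card {w \<in> V. D v \<inter> D w \<noteq> {}}) * M\<^sup>2)"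
    using assms(1) by (simp add: sum.distrib sum.If_cases Int_def)
  also have "\<dots> \<le> (\<Sum>v\<in>V. real (card V) * \<beta>\<^sup>2 + real m * M\<^sup>2)"
    using deg by (intro sum_mono add_left_mono mult_right_mono) auto
  finally show ?thesis by (simp add: power2_eq_square algebra_simps)
qed

section \<open>The smoothed estimator\<close>

lemma sum_cliques_image:
  assumes inj: "inj_on f V"
    and adj: "\<And>x y. x \<in> V \<Longrightarrow> y \<in> V \<Longrightarrow> (f x, f y) \<in> r' \<longleftrightarrow> (x, y) \<in> r"
  shows "(\<Sum>A\<in>cliques r' (f ` V). u (card A)) = (\<Sum>A\<in>cliques r V. u (card A))"
proof -
  have "inj_on ((`) f) (cliques r V)"
    using inj by (intro inj_on_subset [OF inj_on_image_Pow [OF inj]]) (auto simp: cliques_def)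
  moreover have "cliques r' (f ` V) = (`) f ` cliques r V"
  proof (intro equalityI subsetI)
    fix A assume A: "A \<in> cliques r' (f ` V)"
    then obtain B where B: "B \<subseteq> V" "A = f ` B" by (auto simp: cliques_def subset_image_iff)
    then have injB: "inj_on f B" using inj inj_on_subset by blast
    have "(x, y) \<in> r" if "x \<in> B" "y \<in> B" "x \<noteq> y" for x y
    proof -
      have "f x \<noteq> f y" using that injB by (auto dest: inj_onD)
      then have "(f x, f y) \<in> r'" using A B that unfolding cliques_def by blast
      then show ?thesis using adj B that by blast
    qed
    then have "B \<in> cliques r V"
      using A B finite_image_iff [OF injB] by (simp add: cliques_def)
    then show "A \<in> (`) f ` cliques r V" using B by blast
  next
    fix A assume "A \<in> (`) f ` cliques r V"
    then obtain B where B: "B \<in> cliques r V" "A = f ` B" by blast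
    have "(f x, f y) \<in> r'" if "x \<in> B" "y \<in> B" "f x \<noteq> f y" for x y
    proof -
      have "x \<noteq> y" "x \<in> V" "y \<in> V" using that B by (auto simp: cliques_def)
      then show ?thesis using that B adj by (simp add: cliques_def)
    qed
    then show "A \<in> cliques r' (f ` V)" using B by (auto simp: cliques_def)
  qed
  moreover have "card (f ` A) = card A" if "A \<in> cliques r V" for A
    using that inj by (intro card_image) (auto simp: cliques_def intro: inj_on_subset)
  ultimately show ?thesis by (simp add: sum.reindex)
qed

definition clique_estimator :: "(nat \<Rightarrow> real) \<Rightarrow> ('a, 'b) pre_digraph \<Rightarrow> real" where
  "clique_estimator u H = (\<Sum>A\<in>cliques (arcs_ends H) (verts H). u (card A))"

lemma clique_estimator_in_estimators: "clique_estimator u \<in> estimators"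
  unfolding estimators_def
proof (intro CollectI allI impI)
  fix G H :: "(nat, nat \<times> nat) pre_digraph"
  assume "digraph_iso G H"
  then obtain h where h: "pre_digraph.digraph_isomorphism G h" and H: "H = app_iso h G"
    by (auto simp: digraph_iso_def)
  have wf: "wf_digraph G" and inj: "inj_on (iso_verts h) (verts G)"
    and ends: "\<And>a. a \<in> arcs G \<Longrightarrow> iso_tail h (iso_arcs h a) = iso_verts h (tail G a)"
      "\<And>a. a \<in> arcs G \<Longrightarrow> iso_head h (iso_arcs h a) = iso_verts h (head G a)"
    using h by (auto simp: pre_digraph.digraph_isomorphism_def)
  have arcs: "arcs_ends H = map_prod (iso_verts h) (iso_verts h) ` arcs_ends G"
    unfolding H arcs_ends_conv using ends by (auto simp: image_image)
  \<comment> \<open>The vertex map is injective on \<open>verts G\<close> only, so preimages of arcs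
    must have their ends there.\<close>
  have sub: "arcs_ends G \<subseteq> verts G \<times> verts G"
    using wf by (auto simp: arcs_ends_conv wf_digraph_def)
  have adj: "(iso_verts h x, iso_verts h y) \<in> arcs_ends H \<longleftrightarrow> (x, y) \<in> arcs_ends G"
    if "x \<in> verts G" "y \<in> verts G" for x y
  proof
    assume "(iso_verts h x, iso_verts h y) \<in> arcs_ends H"
    then obtain a b where "(a, b) \<in> arcs_ends G" "iso_verts h x = iso_verts h a"
      "iso_verts h y = iso_verts h b" by (auto simp: arcs)
    moreover then have "a \<in> verts G" "b \<in> verts G" using sub by auto
    ultimately show "(x, y) \<in> arcs_ends G"
      using inj_onD [OF inj] that by metis
  next
    assume "(x, y) \<in> arcs_ends G"
    then show "(iso_verts h x, iso_verts h y) \<in> arcs_ends H" unfolding arcs by force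
  qed
  show "clique_estimator u G = clique_estimator u H"
    using sum_cliques_image [OF inj adj, of u] by (simp add: clique_estimator_def H)
qed

lemma clique_estimator_induce_subgraph:
  "clique_estimator u (with_proj G \<restriction> S) = (\<Sum>A\<in>cliques (parcs G) S. u (card A))"
proof -
  have "arcs_ends (with_proj G \<restriction> S) = parcs G \<inter> S \<times> S"
    by (force simp: arcs_ends_conv)
  moreover have "cliques (parcs G \<inter> S \<times> S) S = cliques (parcs G) S"
    by (auto simp: cliques_def)
  ultimately show ?thesis by (simp add: clique_estimator_def)
qed

text \<open>The inverse of the cycle's parametrisation is an isomorphism from the induced subgraph
  on its image to \<open>cycle_graph k\<close>.\<close>

lemma chordal_no_induced_cycle:
  assumes "pair_graph G" "chordal G"
  shows "\<not> has_induced_cycle (parcs G) (pverts G)"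
proof
  interpret pair_graph G by fact
  assume "has_induced_cycle (parcs G) (pverts G)"
  then obtain k f where k: "4 \<le> k" and f: "inj_on f {..<k}" "f ` {..<k} \<subseteq> pverts G"
    and adj: "\<And>i j. i < k \<Longrightarrow> j < k \<Longrightarrow> (f i, f j) \<in> parcs G \<longleftrightarrow> j = Suc i mod k \<or> i = Suc j mod k"
    unfolding has_induced_cycle_def by blast
  define U where "U = f ` {..<k}"
  define g where "g = the_inv_into {..<k} f"
  have g: "g (f i) = i" if "i < k" for i
    using that f by (simp add: g_def the_inv_into_f_f)
  have gU: "\<And>x. x \<in> U \<Longrightarrow> g x < k \<and> f (g x) = x"
    using g by (auto simp: U_def)
  let ?H = "with_proj G \<restriction> U"
  \<comment> \<open>Arcs are pairs of vertices, so they are mapped componentwise and the projections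
    remain tail and head.\<close>
  define h where "h = \<lparr>iso_verts = g, iso_arcs = map_prod g g, iso_head = snd, iso_tail = fst\<rparr>"
  have "inj_on g U" using gU by (metis inj_onI)
  moreover have arcs: "arcs ?H = {(x, y). x \<in> U \<and> y \<in> U \<and> (x, y) \<in> parcs G}" by auto
  moreover have "inj_on (map_prod g g) (arcs ?H)"
    unfolding arcs by (rule inj_onI) (use \<open>inj_on g U\<close> in \<open>auto dest: inj_onD\<close>)
  ultimately have "pre_digraph.digraph_isomorphism ?H h"
    using wellformed_induce_subgraph by (auto simp: pre_digraph.digraph_isomorphism_def h_def)
  moreover have "with_proj (cycle_graph k) = app_iso h ?H"
  proof -
    have "g ` U = {..<k}" using g by (force simp: U_def)
    moreover have "map_prod g g ` arcs ?H = parcs (cycle_graph k)"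
    proof (intro equalityI subsetI)
      fix e assume "e \<in> map_prod g g ` arcs ?H"
      then obtain x y where "x \<in> U" "y \<in> U" "(x, y) \<in> parcs G" "e = (g x, g y)"
        unfolding arcs by auto
      then show "e \<in> parcs (cycle_graph k)"
        using adj [of "g x" "g y"] gU by (simp add: cycle_graph_def)
    next
      fix e assume "e \<in> parcs (cycle_graph k)"
      then obtain i j where e: "e = (i, j)" "i < k" "j < k" "(f i, f j) \<in> parcs G"
        using adj by (auto simp: cycle_graph_def)
      then have "(f i, f j) \<in> arcs ?H" unfolding arcs by (auto simp: U_def)
      moreover have "e = map_prod g g (f i, f j)" using e g by simp
      ultimately show "e \<in> map_prod g g ` arcs ?H" by blast
    qed
    ultimately show ?thesis
      by (simp add: app_iso_def h_def with_proj_def cycle_graph_def)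
  qed
  ultimately have "digraph_iso ?H (with_proj (cycle_graph k))"
    unfolding digraph_iso_def by blast
  then show False using assms(2) k f unfolding chordal_def U_def by blast
qed

text \<open>Symmetric arcs make reachability symmetric, so strong components are plain reachability
  classes.\<close>

lemma cc_eq_card_reach_classes:
  assumes "pair_graph G"
  shows "cc G = card (reach_classes (parcs G) (pverts G))"
proof -
  interpret pair_graph G by fact
  have "u \<rightarrow>\<^sup>*\<^bsub>with_proj G\<^esub> v \<longleftrightarrow>
      u \<in> pverts G \<and> v \<in> pverts G \<and> (u, v) \<in> (parcs G \<inter> pverts G \<times> pverts G)\<^sup>*" for u v
  proof -
    have "parcs G \<inter> pverts G \<times> pverts G = parcs G" using wellformed' by auto
    then show ?thesis using reachable_conv by auto
  qed
  moreover have "u \<rightarrow>\<^sup>*\<^bsub>with_proj G\<^esub> v \<longleftrightarrow> v \<rightarrow>\<^sup>*\<^bsub>with_proj G\<^esub> u" for u v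
    using symmetric_reachable' by blast
  ultimately have "scc_of v = {u \<in> pverts G. (v, u) \<in> (parcs G \<inter> pverts G \<times> pverts G)\<^sup>*}"
    if "v \<in> pverts G" for v
    using that unfolding scc_of_def by blast
  then have "scc_of ` pverts G = reach_classes (parcs G) (pverts G)"
    unfolding reach_classes_def by (intro image_cong) auto
  then show ?thesis
    unfolding cc_def card_sccs_verts [symmetric] sccs_verts_conv_scc_of by simp
qed

section \<open>Binomial inversion and the smoothed weights\<close>

lemma sum_Pow_card:
  fixes u :: "nat \<Rightarrow> real"
  assumes "finite A"
  shows "(\<Sum>B\<in>Pow A. u (card B)) = (\<Sum>i\<le>card A. real (card A choose i) * u i)"
proof -
  have "(\<Sum>B\<in>Pow A. u (card B)) = (\<Sum>i\<le>card A. \<Sum>B | B \<in> Pow A \<and> card B = i. u (card B))"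
    using assms by (intro sum.group [symmetric]) (auto intro: card_mono)
  also have "\<dots> = (\<Sum>i\<le>card A. real (card A choose i) * u i)"
    using n_subsets [OF assms] by (intro sum.cong) simp_all
  finally show ?thesis .
qed

text \<open>Solves the triangular system of \<open>sum_binomial_inverse\<close> recursively, which
  avoids the explicit alternating formula.\<close>

fun binomial_inverse :: "(nat \<Rightarrow> real) \<Rightarrow> nat \<Rightarrow> real" where
  "binomial_inverse g n = g n - (\<Sum>i<n. real (n choose i) * binomial_inverse g i)"

declare binomial_inverse.simps [simp del]

lemma sum_binomial_inverse: "(\<Sum>i\<le>n. real (n choose i) * binomial_inverse g i) = g n"
  by (simp add: lessThan_Suc_atMost [symmetric] binomial_inverse.simps [of g n])

text \<open>Without the factor \<open>poisson_tail\<close> these weights give the unbiased estimator, whose variance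
  is too large for \<open>p < 1/2\<close>.\<close>

definition smoothed_weight :: "real \<Rightarrow> real \<Rightarrow> nat \<Rightarrow> real" where
  "smoothed_weight a p k = (- ((1 - p) / p)) ^ k * poisson_tail a k / p"

text \<open>The shift \<open>k - 1\<close> discounts the first eliminated vertex of a clique: only
  the other members are parents.\<close>

definition smoothed_estimator :: "real \<Rightarrow> real \<Rightarrow> ('a, 'b) pre_digraph \<Rightarrow> real" where
  "smoothed_estimator a p = clique_estimator (\<lambda>k. binomial_inverse (smoothed_weight a p) (k - 1))"

text \<open>Tilting with \<open>r = (1 - p) / p\<close>, which exceeds 1 because
  \<open>p < 1 / 2\<close>.\<close>

lemma abs_smoothed_weight_le:
  assumes "0 \<le> a" "0 < p" "p < 1 / 2"
  shows "\<bar>smoothed_weight a p k\<bar> \<le> exp (a * (1 - 2 * p) / p) / p"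
proof -
  have "\<bar>smoothed_weight a p k\<bar> = ((1 - p) / p) ^ k * poisson_tail a k / p"
    using assms poisson_tail_nonneg [of a k]
    by (simp add: smoothed_weight_def abs_mult power_abs)
  also have "\<dots> \<le> exp (a * ((1 - p) / p - 1)) / p"
    using assms by (intro divide_right_mono power_poisson_tail_le) auto
  also have "a * ((1 - p) / p - 1) = a * (1 - 2 * p) / p"
    using assms by (simp add: field_simps)
  finally show ?thesis .
qed

text \<open>The bias of one vertex with \<open>c\<close> parents. The powers of \<open>p\<close>
  cancel and every term acquires the same \<open>(1 - p) ^ c\<close>, leaving the alternating tail
  sum. For \<open>c = 0\<close> the bias is exactly zero.\<close>

lemma abs_smoothed_weight_mean_le:
  assumes "0 \<le> a" "0 < p" "p < 1 / 2"
  shows "\<bar>p * (\<Sum>k\<le>c. real (c choose k) * p ^ k * (1 - p) ^ (c - k) * smoothed_weight a p k)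
      - (if c = 0 then 1 else 0)\<bar> \<le> exp (- a / 2)"
proof (cases "c = 0")
  case True
  then show ?thesis using assms by (simp add: smoothed_weight_def)
next
  case False
  let ?A = "\<Sum>k\<le>c. real (c choose k) * (-1) ^ k * poisson_tail a k"
  have "p * (\<Sum>k\<le>c. real (c choose k) * p ^ k * (1 - p) ^ (c - k) * smoothed_weight a p k) = (1 - p) ^ c * ?A"
    unfolding sum_distrib_left
  proof (intro sum.cong refl)
    fix k assume "k \<in> {..c}"
    then have "(1 - p) ^ c = (1 - p) ^ (c - k) * (1 - p) ^ k" by (simp flip: power_add)
    moreover have "p ^ k * (- ((1 - p) / p)) ^ k = (-1) ^ k * (1 - p) ^ k"
      using assms by (simp flip: power_mult_distrib)
    ultimately show "p * (real (c choose k) * p ^ k * (1 - p) ^ (c - k) * smoothed_weight a p k) =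
        (1 - p) ^ c * (real (c choose k) * (-1) ^ k * poisson_tail a k)"
      using assms by (simp add: smoothed_weight_def)
  qed
  moreover have "\<bar>(1 - p) ^ c * ?A\<bar> \<le> 1 * exp (- a / 2)"
    unfolding abs_mult using assms False
    by (intro mult_mono abs_alternating_poisson_tail_sum_le) (auto simp: power_le_one_iff power_abs)
  ultimately show ?thesis using False by simp
qed

section \<open>Mean squared error of the smoothed estimator\<close>

text \<open>A common point puts \<open>w\<close> in the closed neighbourhood of a point of the
  closed neighbourhood of \<open>v\<close>; each of these has at most \<open>Suc d\<close>
  elements.\<close>

lemma card_intersecting_neighbourhoods:
  assumes "finite V" "sym r"
    and deg: "\<And>v. v \<in> V \<Longrightarrow> card {x \<in> V. (v, x) \<in> r} \<le> d"
    and D: "\<And>v. v \<in> V \<Longrightarrow> D v \<subseteq> insert v {x \<in> V. (v, x) \<in> r}"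
    and v: "v \<in> V"
  shows "card {w \<in> V. D v \<inter> D w \<noteq> {}} \<le> (Suc d)\<^sup>2"
proof -
  define N where "N x = insert x {y \<in> V. (x, y) \<in> r}" for x
  have fin: "finite (N x)" for x using \<open>finite V\<close> by (simp add: N_def)
  have N: "card (N x) \<le> Suc d" if "x \<in> V" for x
    using deg [OF that] card_insert_le_m1 [of "Suc d" "{y \<in> V. (x, y) \<in> r}" x] by (simp add: N_def)
  have NV: "N v \<subseteq> V" using v by (auto simp: N_def)
  have "{w \<in> V. D v \<inter> D w \<noteq> {}} \<subseteq> (\<Union>x\<in>N v. N x)"
  proof
    fix w assume "w \<in> {w \<in> V. D v \<inter> D w \<noteq> {}}"
    then obtain x where "w \<in> V" "x \<in> D v" "x \<in> D w" by blast
    then have "x \<in> N v" "x \<in> N w" using D v by (auto simp: N_def)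
    then have "w \<in> N x" using \<open>w \<in> V\<close> \<open>sym r\<close> by (auto simp: N_def dest: symD)
    then show "w \<in> (\<Union>x\<in>N v. N x)" using \<open>x \<in> N v\<close> by blast
  qed
  then have "card {w \<in> V. D v \<inter> D w \<noteq> {}} \<le> card (\<Union>x\<in>N v. N x)"
    using fin by (intro card_mono) auto
  also have "\<dots> \<le> (\<Sum>x\<in>N v. card (N x))" using fin by (intro card_UN_le)
  also have "\<dots> \<le> (\<Sum>x\<in>N v. Suc d)" using N NV by (intro sum_mono) blast
  also have "\<dots> = card (N v) * Suc d" by simp
  also have "\<dots> \<le> Suc d * Suc d" by (intro mult_right_mono N v) simp
  finally show ?thesis by (simp add: power2_eq_square)
qed

text \<open>The error is a sum of local terms, each depending on the sample only within
  \<open>insert v (P v)\<close>. The constant 16 is 4 from \<open>Suc d \<le> 2 * d\<close> times 4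
  from squaring the 2 in \<open>M\<close>.\<close>

lemma mean_squared_error_smoothed_le:
  assumes G: "G \<in> chordal_graphs N d" and "1 \<le> d" "0 < p" "p < 1 / 2" "0 \<le> a"
  shows "mean_squared_error (smoothed_estimator a p) p G \<le>
    (real N)\<^sup>2 * exp (- a) + 16 * real N * (real d)\<^sup>2 * exp (2 * (a * (1 - 2 * p) / p)) / p\<^sup>2"
proof -
  define V r where "V = pverts G" and "r = parcs G"
  have pg: "pair_graph G" and ch: "chordal G" and cardV: "card V = N"
    and outdeg: "\<And>v. v \<in> V \<Longrightarrow> out_degree (with_proj G) v \<le> d"
    using G by (auto simp: chordal_graphs_def V_def)
  interpret pair_graph G by fact
  have fin: "finite V" using pair_finite_verts by (simp add: V_def)
  have sym: "sym r" using pair_sym_arcs by (simp add: symmetric_def r_def)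
  have irr: "irrefl r" using pair_no_loops by (force simp: irrefl_def r_def)
  have rV: "r \<subseteq> V \<times> V" using wellformed' by (auto simp: r_def V_def)
  have deg: "card {x \<in> V. (v, x) \<in> r} \<le> d" if "v \<in> V" for v
  proof -
    have "out_arcs (with_proj G) v = Pair v ` {x \<in> V. (v, x) \<in> r}"
      using rV by (auto simp: out_arcs_def r_def)
    then have "out_degree (with_proj G) v = card {x \<in> V. (v, x) \<in> r}"
      by (simp add: out_degree_def card_image inj_on_def)
    then show ?thesis using outdeg [OF that] by simp
  qed
  have "\<not> has_induced_cycle r V"
    using chordal_no_induced_cycle [OF pg ch] by (simp add: r_def V_def)
  then obtain P where "parent_map r V P"
    using parent_map_exists [OF fin sym irr] by blast
  then have P: "\<And>v. v \<in> V \<Longrightarrow> P v \<subseteq> {x \<in> V. (v, x) \<in> r}"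
    and ccP: "card (reach_classes r V) = card {v \<in> V. P v = {}}"
    and cliqueP: "\<And>S u. S \<subseteq> V \<Longrightarrow> (\<Sum>A\<in>cliques r S. u (card A) :: real) =
       (\<Sum>v\<in>S. \<Sum>B\<in>Pow (P v \<inter> S). u (Suc (card B)))"
    by (simp_all add: parent_map_def)
  define D where "D v = insert v (P v)" for v
  define Z where "Z v S = (if v \<in> S then smoothed_weight a p (card (P v \<inter> S)) else 0) - (if P v = {} then 1 else 0)"
    for v S
  have PV: "P v \<subseteq> V" "v \<notin> P v" "finite (P v)" if "v \<in> V" for v
    using P [OF that] irr finite_subset [OF _ fin, of "P v"] by (auto simp: irrefl_def)
  have est: "smoothed_estimator a p (with_proj G \<restriction> S) - real (cc G) = (\<Sum>v\<in>V. Z v S)" if S: "S \<subseteq> V" for S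
  proof -
    have "smoothed_estimator a p (with_proj G \<restriction> S) =
        (\<Sum>v\<in>S. \<Sum>B\<in>Pow (P v \<inter> S). binomial_inverse (smoothed_weight a p) (card B))"
      using cliqueP [OF S, of "\<lambda>k. binomial_inverse (smoothed_weight a p) (k - 1)"]
      by (simp add: smoothed_estimator_def clique_estimator_induce_subgraph r_def)
    also have "\<dots> = (\<Sum>v\<in>S. smoothed_weight a p (card (P v \<inter> S)))"
    proof (intro sum.cong refl)
      fix v assume "v \<in> S"
      then have "finite (P v \<inter> S)" using PV S by blast
      then show "(\<Sum>B\<in>Pow (P v \<inter> S). binomial_inverse (smoothed_weight a p) (card B)) = smoothed_weight a p (card (P v \<inter> S))"
        by (simp only: sum_Pow_card sum_binomial_inverse)
    qed
    also have "\<dots> = (\<Sum>v\<in>V. if v \<in> S then smoothed_weight a p (card (P v \<inter> S)) else 0)"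
      using S fin by (simp add: sum.If_cases Int_absorb1)
    finally have "smoothed_estimator a p (with_proj G \<restriction> S) =
      (\<Sum>v\<in>V. if v \<in> S then smoothed_weight a p (card (P v \<inter> S)) else 0)" .
    moreover have "real (cc G) = (\<Sum>v\<in>V. if P v = {} then 1 else 0)"
      using ccP fin cc_eq_card_reach_classes [OF pg] by (simp add: r_def V_def sum.If_cases Int_def)
    ultimately show ?thesis by (simp add: Z_def sum_subtractf)
  qed
  \<comment> \<open>Twice the weight bound: one copy for the weight, one dominating the indicator
    1.\<close>
  define M where "M = 2 * exp (a * (1 - 2 * p) / p) / p"
  have "mean_squared_error (smoothed_estimator a p) p G = expect V p (\<lambda>S. (\<Sum>v\<in>V. Z v S)\<^sup>2)"
    unfolding mean_squared_error_def V_def [symmetric] by (rule expect_cong) (simp add: est)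
  also have "\<dots> \<le> (real (card V))\<^sup>2 * (exp (- a / 2))\<^sup>2 + real (card V) * real ((Suc d)\<^sup>2) * M\<^sup>2"
  proof (rule expect_square_sum_le [where D = D])
    show "D v \<subseteq> V" if "v \<in> V" for v using PV that by (auto simp: D_def)
    show "Z v (S \<inter> D v) = Z v S" for v S
    proof -
      have "P v \<inter> (S \<inter> D v) = P v \<inter> S" by (auto simp: D_def)
      then show ?thesis unfolding Z_def by (simp only:) (simp add: D_def)
    qed
    show "\<bar>Z v S\<bar> \<le> M" for v S
    proof -
      have "1 \<le> exp (a * (1 - 2 * p) / p)" using assms by simp
      also have "\<dots> \<le> exp (a * (1 - 2 * p) / p) / p" using assms by (simp add: field_simps)
      finally have 1: "1 \<le> exp (a * (1 - 2 * p) / p) / p" .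
      have M: "M = exp (a * (1 - 2 * p) / p) / p + exp (a * (1 - 2 * p) / p) / p" by (simp add: M_def)
      show ?thesis using 1 abs_smoothed_weight_le [OF assms(5,3,4), of "card (P v \<inter> S)"] unfolding Z_def M
        by (auto split: if_splits)
    qed
    show "\<bar>expect V p (Z v)\<bar> \<le> exp (- a / 2)" if v: "v \<in> V" for v
    proof -
      have "expect V p (Z v) =
        expect V p (\<lambda>S. if v \<in> S then smoothed_weight a p (card (P v \<inter> S)) else 0) - (if P v = {} then 1 else 0)"
        unfolding Z_def using fin by (subst Bochner_Integration.integral_diff) (auto intro: integrable_bernoulli_subset)
      also have "\<dots> = p * (\<Sum>k\<le>card (P v). real (card (P v) choose k) * p ^ k * (1 - p) ^ (card (P v) - k) * smoothed_weight a p k)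
          - (if card (P v) = 0 then 1 else 0)"
        using PV [OF v] fin v assms by (subst expect_vertex_card) auto
      finally show ?thesis using abs_smoothed_weight_mean_le [OF assms(5,3,4)] by simp
    qed
    show "card {w \<in> V. D v \<inter> D w \<noteq> {}} \<le> (Suc d)\<^sup>2" if "v \<in> V" for v
      by (rule card_intersecting_neighbourhoods [OF fin sym deg _ that]) (use P in \<open>auto simp: D_def\<close>)
  qed (use assms fin in auto)
  also have "(exp (- a / 2))\<^sup>2 = exp (- a)" by (simp add: power2_eq_square flip: exp_add)
  also have "real (card V) * real ((Suc d)\<^sup>2) * M\<^sup>2 \<le> real (card V) * (4 * (real d)\<^sup>2) * M\<^sup>2"
  proof -
    have "(Suc d)\<^sup>2 \<le> (2 * d)\<^sup>2" using assms by (intro power_mono) auto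
    then have "real ((Suc d)\<^sup>2) \<le> real ((2 * d)\<^sup>2)" by (simp only: of_nat_le_iff)
    then show ?thesis by (intro mult_right_mono mult_left_mono) (simp_all add: power_mult_distrib)
  qed
  also have "M\<^sup>2 = 4 * exp (2 * (a * (1 - 2 * p) / p)) / p\<^sup>2"
    by (simp add: M_def power_divide power_mult_distrib exp_double [symmetric])
  finally show ?thesis by (simp add: cardV)
qed

section \<open>Choice of the smoothing parameter and the minimax bound\<close>

text \<open>The trivial estimator serves when \<open>N / d\<^sup>2\<close> is too small for
  smoothing to help.\<close>

lemma mean_squared_error_zero_le:
  assumes "G \<in> chordal_graphs N d"
  shows "mean_squared_error (\<lambda>_. 0) p G \<le> (real N)\<^sup>2"
proof -
  have pg: "pair_graph G" and N: "card (pverts G) = N"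
    using assms by (auto simp: chordal_graphs_def)
  have "finite (pverts G)" using pg by (simp add: pair_graph_def pair_digraph_def pair_fin_digraph.pair_finite_verts)
  then have "cc G \<le> N"
    unfolding cc_eq_card_reach_classes [OF pg] reach_classes_def N [symmetric] by (rule card_image_le)
  then show ?thesis by (simp add: mean_squared_error_def)
qed

lemma minimax_risk_le:
  assumes "est \<in> estimators" "\<And>G. G \<in> chordal_graphs N d \<Longrightarrow> mean_squared_error est p G \<le> B"
  shows "minimax_risk N d p \<le> ennreal B"
  unfolding minimax_risk_def
  by (rule INF_lower2 [OF assms(1)]) (intro SUP_least ennreal_leI assms(2))

theorem theorem3:
  shows "\<exists>C::real. \<forall>N d :: nat. \<forall>p::real. 1 \<le> N \<longrightarrow> 1 \<le> d \<longrightarrow> 0 < p \<longrightarrow> p < 1 / 2 \<longrightarrow>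
    minimax_risk N d p
      \<le> ennreal (C * (real N)\<^sup>2 * (real N / (real d)\<^sup>2) powr (- (p / (2 - 3 * p))))"
proof (intro exI [of _ "exp 1 + 16 * exp 4"] allI impI)
  fix N d :: nat and p :: real
  assume N: "1 \<le> N" and d: "1 \<le> d" and p: "0 < p" "p < 1 / 2"
  define x where "x = real N / (real d)\<^sup>2"
  \<comment> \<open>The value of \<open>a\<close> at which the exponential parts of the bias and
    variance bounds agree; the target rate is \<open>exp (- l)\<close>.\<close>
  define l where "l = p / (2 - 3 * p) * ln x"
  \<comment> \<open>The first summand pays for the squared bias and for the trivial regime
    \<open>l \<le> 1\<close>, the second for the variance.\<close>
  define C :: real where "C = exp 1 + 16 * exp 4"
  have x: "0 < x" using N d by (simp add: x_def)
  have powr: "x powr (- (p / (2 - 3 * p))) = exp (- l)"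
    using x by (simp add: powr_def l_def)
  have "minimax_risk N d p \<le> ennreal (C * (real N)\<^sup>2 * exp (- l))"
  proof (cases "l \<le> 1")
    case True
    have "1 \<le> exp 1 * exp (- l)" using True by (simp flip: exp_add)
    also have "\<dots> \<le> C * exp (- l)" by (simp add: C_def)
    finally have C: "1 * (real N)\<^sup>2 \<le> C * exp (- l) * (real N)\<^sup>2" by (rule mult_right_mono) simp
    show ?thesis
    proof (rule minimax_risk_le [of "\<lambda>_. 0"])
      fix G assume "G \<in> chordal_graphs N d"
      from mean_squared_error_zero_le [OF this, of p] C
      show "mean_squared_error (\<lambda>_. 0) p G \<le> C * (real N)\<^sup>2 * exp (- l)" by (simp add: mult_ac)
    qed (simp add: estimators_def)
  next
    case False
    \<comment> \<open>Lowering the balance point by one costs \<open>exp 1\<close> in the bias and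
      gains \<open>exp (4 - 2 / p)\<close> in the variance, which beats
      \<open>1 / p\<^sup>2\<close>.\<close>
    define a where "a = l - 1"
    have a: "0 \<le> a" using False by (simp add: a_def)
    have lnx: "ln x = l * (2 - 3 * p) / p" using p by (simp add: l_def)
    have "(real d)\<^sup>2 = real N / x" using d N by (simp add: x_def)
    also have "\<dots> = real N * exp (- ln x)" using x by (simp add: exp_minus divide_inverse)
    finally have d2: "(real d)\<^sup>2 = real N * exp (- ln x)" .
    have "p\<^sup>2 * exp (2 / p) \<ge> 1"
    proof -
      have "1 / p \<le> exp (1 / p)" using exp_ge_add_one_self [of "1 / p"] by linarith
      then have "1 \<le> p * exp (1 / p)" using p by (simp add: field_simps)
      then have "1 \<le> (p * exp (1 / p))\<^sup>2" by simp
      also have "\<dots> = p\<^sup>2 * exp (2 / p)"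
        by (simp add: power_mult_distrib exp_double [symmetric])
      finally show ?thesis .
    qed
    then have p2: "exp (- (2 / p)) / p\<^sup>2 \<le> 1"
      using p by (simp add: exp_minus field_simps)
    \<comment> \<open>The coefficient of \<open>l\<close> is
      \<open>(2 * (1 - 2 * p) - (2 - 3 * p)) / p = -1\<close>; this fixes the exponent
      \<open>p / (2 - 3 * p)\<close>.\<close>
    have "- ln x + 2 * (a * (1 - 2 * p) / p) = 4 - l - 2 / p"
      unfolding lnx a_def using p by (simp add: field_simps)
    then have "exp (- ln x) * exp (2 * (a * (1 - 2 * p) / p)) = exp 4 * exp (- l) * exp (- (2 / p))"
      by (simp flip: exp_add)
    then have "16 * real N * (real d)\<^sup>2 * exp (2 * (a * (1 - 2 * p) / p)) / p\<^sup>2 =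
        16 * exp 4 * (real N)\<^sup>2 * exp (- l) * (exp (- (2 / p)) / p\<^sup>2)"
      unfolding d2 by (simp add: power2_eq_square)
    also have "\<dots> \<le> 16 * exp 4 * (real N)\<^sup>2 * exp (- l) * 1"
      using p2 by (intro mult_left_mono) auto
    finally have var: "16 * real N * (real d)\<^sup>2 * exp (2 * (a * (1 - 2 * p) / p)) / p\<^sup>2
        \<le> 16 * exp 4 * (real N)\<^sup>2 * exp (- l)" by simp
    have bias: "exp (- a) = exp 1 * exp (- l)" by (simp add: a_def flip: exp_add)
    show ?thesis
    proof (rule minimax_risk_le [of "smoothed_estimator a p"])
      show "smoothed_estimator a p \<in> estimators"
        unfolding smoothed_estimator_def by (rule clique_estimator_in_estimators)
    next
      fix G assume "G \<in> chordal_graphs N d"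
      from mean_squared_error_smoothed_le [OF this d p a] var
      have "mean_squared_error (smoothed_estimator a p) p G
          \<le> (real N)\<^sup>2 * exp (- a) + 16 * exp 4 * (real N)\<^sup>2 * exp (- l)" by linarith
      also have "\<dots> = C * (real N)\<^sup>2 * exp (- l)"
        unfolding bias C_def by (simp add: algebra_simps)
      finally show "mean_squared_error (smoothed_estimator a p) p G \<le> C * (real N)\<^sup>2 * exp (- l)" .
    qed
  qed
  then show "minimax_risk N d p
      \<le> ennreal ((exp 1 + 16 * exp 4) * (real N)\<^sup>2 * (real N / (real d)\<^sup>2) powr (- (p / (2 - 3 * p))))"
    unfolding x_def [symmetric] powr C_def .
qed

end
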